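(* Let $p,N\ge 1$ be integers, let $\eta=\{1,\dots,N\}$, and let $\mathscr{L}$ be the algebra of mixed multidimensional integral operators on $L^2([0,1)^N)$ with $p$-step kernels (defined in the context). For $\mathcal{A}\in\mathscr{L}$ with coefficients $a_\alpha(\mathbf{i},\mathbf{m})$ ($\alpha\subset\eta$, $\mathbf{i}\in P_\eta$, $\mathbf{m}\in P_\alpha$) put $$b_\alpha(\mathbf{i},\mathbf{m})=\sum_{\beta\subset\alpha}\delta(\mathbf{i}_{\alpha\setminus\beta},\mathbf{m}_{\alpha\setminus\beta})\,a_\beta(\mathbf{i},\mathbf{m}_\beta),\qquad \alpha\subset\eta,\ \mathbf{i}\in P_\eta,\ \mathbf{m}\in P_\alpha,$$ and for $\alpha\subset\eta$, $\mathbf{i}\in P_{\overline{\alpha}}$ define the matrix $$\mathbf{B}_\alpha(\mathbf{i})=\big(b_\alpha(\mathbf{i}\diamond\mathbf{m},\mathbf{n})\big)_{\mathbf{m},\mathbf{n}\in P_\alpha}\in\mathbb{C}^{p^{|\alpha|}\times p^{|\alpha|}}.$$ Then the mapping $$\sigma:\mathscr{L}\to\prod_{\alpha\subset\eta}\prod_{\mathbf{i}\in P_{\overline{\alpha}}}\mathbb{C}^{p^{|\alpha|}\times p^{|\alpha|}}=\prod_{n=0}^N\big(\mathbb{C}^{p^n\times p^n}\big)^{\binom{N}{n}p^{N-n}},\qquad \sigma(\mathcal{A})=\big((\mathbf{B}_\alpha(\mathbf{i}))_{\mathbf{i}\in P_{\overline{\alpha}}}\big)_{\alpha\subset\eta},$$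 is an algebra isomorphism.
   Context: Notation. Fix integers $p,N\ge1$ and $\eta=\{1,\dots,N\}$. The symbol $\alpha\subset\eta$ allows $\alpha=\emptyset$ and $\alpha=\eta$; $\overline{\alpha}=\eta\setminus\alpha$; $|\alpha|$ is the number of elements of $\alpha$. For $\alpha\subset\eta$, $P_\alpha=\{\mathbf{m}=(m_n)_{n\in\alpha}: m_n\in\{1,\dots,p\}\}$ (so $P_\emptyset$ has one element, the empty multi-index). For $\mathbf{x}=(x_n)_{n\in\gamma}$ and $\alpha\subset\gamma$, $\mathbf{x}_\alpha=(x_n)_{n\in\alpha}$. For disjoint $\alpha,\beta$ and vectors $\mathbf{x}_\alpha=(x_n)_{n\in\alpha}$, $\mathbf{y}_\beta=(y_n)_{n\in\beta}$, $\mathbf{x}_\alpha\diamond\mathbf{y}_\beta=\mathbf{y}_\beta\diamond\mathbf{x}_\alpha$ is the vector $(z_n)_{n\in\alpha\cup\beta}$ with $z_n=x_n$ for $n\in\alpha$ and $z_n=y_n$ for $n\in\beta$. The Kronecker delta is $\delta(x,y)=1$ if $x=y$ and $0$ otherwise (and equals $1$ for two empty multi-indices). For $r\in\{1,\dots,p\}$, $\chi_r(y)=1$ if $y\in[(r-1)/p,r/p)$ and $\chi_r(y)=0$ otherwise. The algebra $\mathscr{L}$. Let $L^2=L^2([0,1)^N)$ be the Hilbert space of complex-valued square-integrable functions. $\mathscr{L}$ is the set of all operators $\mathcal{A}:L^2\to L^2$ of the form $$\mathcal{A}u(\mathbf{k})=\sum_{\alpha\subset\eta}\int_{[0,1)^{|\alpha|}}A_\alpha(\mathbf{k},\mathbf{x}_\alpha)\,u(\mathbf{k}_{\overline{\alpha}}\diamond\mathbf{x}_\alpha)\,d\mathbf{x}_\alpha,$$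 where $d\mathbf{x}_\alpha=\prod_{n\in\alpha}dx_n$ is Lebesgue measure, the term for $\alpha=\emptyset$ is $A_\emptyset(\mathbf{k})u(\mathbf{k})$, and $$A_\alpha(\mathbf{k},\mathbf{x}_\alpha)=\sum_{(\mathbf{i},\mathbf{m})\in P_\eta\times P_\alpha}p^{|\alpha|}a_\alpha(\mathbf{i},\mathbf{m})\prod_{j\in\eta}\chi_{i_j}(k_j)\prod_{n\in\alpha}\chi_{m_n}(x_n),\qquad a_\alpha(\mathbf{i},\mathbf{m})\in\mathbb{C}.$$ $\mathscr{L}$ is a subalgebra (containing the identity operator) of the algebra of bounded operators on $L^2$, with composition as product; the coefficients $a_\alpha(\mathbf{i},\mathbf{m})$ are uniquely determined by $\mathcal{A}$. The target of $\sigma$ is a direct product of matrix algebras with componentwise operations. *)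

theory Defs
  imports "HOL-Analysis.Analysis" "HOL-Algebra.Module" "HOL-Algebra.QuotRing"
begin

section \<open>Unital associative algebras, products and matrix algebras\<close>

text \<open>
  The locale \<open>algebra\<close> of HOL-Algebra only covers commutative algebras, so the
  noncommutative notion is built here from \<open>module\<close> and \<open>ring\<close>.
\<close>

definition unital_algebra ::
    "('r, 's) ring_scheme \<Rightarrow> ('r, 'a, 't) module_scheme \<Rightarrow> bool" where
  "unital_algebra R A \<longleftrightarrow> module R A \<and> ring A \<and>
     (\<forall>c\<in>carrier R. \<forall>x\<in>carrier A. \<forall>y\<in>carrier A.
        (c \<odot>\<^bsub>A\<^esub> x) \<otimes>\<^bsub>A\<^esub> y = c \<odot>\<^bsub>A\<^esub> (x \<otimes>\<^bsub>A\<^esub> y) \<and>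
        x \<otimes>\<^bsub>A\<^esub> (c \<odot>\<^bsub>A\<^esub> y) = c \<odot>\<^bsub>A\<^esub> (x \<otimes>\<^bsub>A\<^esub> y))"

definition algebra_isomorphism ::
    "('r, 's) ring_scheme \<Rightarrow> ('r, 'a, 't) module_scheme \<Rightarrow> ('r, 'b, 'u) module_scheme \<Rightarrow>
      ('a \<Rightarrow> 'b) \<Rightarrow> bool" where
  "algebra_isomorphism R A B f \<longleftrightarrow>
     unital_algebra R A \<and> unital_algebra R B \<and> f \<in> ring_iso A B \<and>
     (\<forall>c\<in>carrier R. \<forall>x\<in>carrier A. f (c \<odot>\<^bsub>A\<^esub> x) = c \<odot>\<^bsub>B\<^esub> f x)"

definition complex_field :: "complex ring" where
  "complex_field = \<lparr>carrier = UNIV, mult = (*), one = 1, zero = 0, add = (+)\<rparr>"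

definition product_algebra ::
    "'i set \<Rightarrow> ('i \<Rightarrow> ('r, 'a) module) \<Rightarrow> ('r, 'i \<Rightarrow> 'a) module" where
  "product_algebra I A =
     \<lparr>carrier = (\<Pi>\<^sub>E i\<in>I. carrier (A i)),
      mult = (\<lambda>x y. \<lambda>i\<in>I. x i \<otimes>\<^bsub>A i\<^esub> y i),
      one = (\<lambda>i\<in>I. \<one>\<^bsub>A i\<^esub>),
      zero = (\<lambda>i\<in>I. \<zero>\<^bsub>A i\<^esub>),
      add = (\<lambda>x y. \<lambda>i\<in>I. x i \<oplus>\<^bsub>A i\<^esub> y i),
      smult = (\<lambda>c x. \<lambda>i\<in>I. c \<odot>\<^bsub>A i\<^esub> x i)\<rparr>"

text \<open>
  Complex square matrices whose rows and columns are indexed by a finite set \<open>I\<close>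
  (below: a set of multi-indices, or \<open>{1..d}\<close>).
\<close>

definition matrix_algebra :: "'k set \<Rightarrow> (complex, 'k \<times> 'k \<Rightarrow> complex) module" where
  "matrix_algebra I =
     \<lparr>carrier = I \<times> I \<rightarrow>\<^sub>E UNIV,
      mult = (\<lambda>X Y. \<lambda>(m, n)\<in>I \<times> I. \<Sum>l\<in>I. X (m, l) * Y (l, n)),
      one = (\<lambda>(m, n)\<in>I \<times> I. of_bool (m = n)),
      zero = (\<lambda>(m, n)\<in>I \<times> I. 0),
      add = (\<lambda>X Y. \<lambda>(m, n)\<in>I \<times> I. X (m, n) + Y (m, n)),
      smult = (\<lambda>c X. \<lambda>(m, n)\<in>I \<times> I. c * X (m, n))\<rparr>"


section \<open>The space \<open>L\<^sup>2([0,1)\<^sup>N)\<close>\<close>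

text \<open>
  A point of \<open>[0,1)\<^sup>\<gamma>\<close> is a function on \<open>\<gamma>\<close> (extended by \<open>undefined\<close>). For \<open>\<gamma> = {}\<close>
  this is the unit point mass.
\<close>

definition cube :: "nat set \<Rightarrow> (nat \<Rightarrow> real) measure" where
  "cube \<gamma> = (\<Pi>\<^sub>M n\<in>\<gamma>. restrict_space lborel {0..<1})"

definition square_integrable :: "nat \<Rightarrow> ((nat \<Rightarrow> real) \<Rightarrow> complex) set" where
  "square_integrable N =
     {u \<in> borel_measurable (cube {1..N}). integrable (cube {1..N}) (\<lambda>k. (cmod (u k))\<^sup>2)}"

definition ae_equal ::
    "nat \<Rightarrow> (((nat \<Rightarrow> real) \<Rightarrow> complex) \<times> ((nat \<Rightarrow> real) \<Rightarrow> complex)) set" where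
  "ae_equal N = {(u, v). u \<in> square_integrable N \<and> v \<in> square_integrable N \<and>
                         (AE k in cube {1..N}. u k = v k)}"

definition L2 :: "nat \<Rightarrow> ((nat \<Rightarrow> real) \<Rightarrow> complex) set set" where
  "L2 N = square_integrable N // ae_equal N"

text \<open>
  Here and in \<open>mixed_op\<close>, maps are lifted to classes by taking the union, over all
  representatives, of the classes of the results; as all these classes coincide, the
  union is the common class.
\<close>

definition L2_zero :: "nat \<Rightarrow> ((nat \<Rightarrow> real) \<Rightarrow> complex) set" where
  "L2_zero N = ae_equal N `` {\<lambda>k. 0}"

definition L2_add :: "nat \<Rightarrow> ((nat \<Rightarrow> real) \<Rightarrow> complex) set \<Rightarrow>
    ((nat \<Rightarrow> real) \<Rightarrow> complex) set \<Rightarrow> ((nat \<Rightarrow> real) \<Rightarrow> complex) set" where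
  "L2_add N U V = (\<Union>u\<in>U. \<Union>v\<in>V. ae_equal N `` {\<lambda>k. u k + v k})"

definition L2_scale :: "nat \<Rightarrow> complex \<Rightarrow>
    ((nat \<Rightarrow> real) \<Rightarrow> complex) set \<Rightarrow> ((nat \<Rightarrow> real) \<Rightarrow> complex) set" where
  "L2_scale N c U = (\<Union>u\<in>U. ae_equal N `` {\<lambda>k. c * u k})"


section \<open>The operator algebra\<close>

definition multi_indices :: "nat \<Rightarrow> nat set \<Rightarrow> (nat \<Rightarrow> nat) set" where
  "multi_indices p \<alpha> = \<alpha> \<rightarrow>\<^sub>E {1..p}"

text \<open>
  A coefficient family sends \<open>(\<alpha>, i, m)\<close> to \<open>a\<^sub>\<alpha>(i, m)\<close>; being extensional, it carries no
  data beyond these values.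
\<close>

type_synonym coefficients = "nat set \<times> (nat \<Rightarrow> nat) \<times> (nat \<Rightarrow> nat) \<Rightarrow> complex"

definition coefficient_families :: "nat \<Rightarrow> nat \<Rightarrow> coefficients set" where
  "coefficient_families p N =
     (SIGMA \<alpha>:Pow {1..N}. multi_indices p {1..N} \<times> multi_indices p \<alpha>) \<rightarrow>\<^sub>E UNIV"

definition step :: "nat \<Rightarrow> nat \<Rightarrow> real \<Rightarrow> complex" where
  "step p r = indicator {(real r - 1) / real p ..< real r / real p}"

definition step_kernel :: "nat \<Rightarrow> nat \<Rightarrow> coefficients \<Rightarrow> nat set \<Rightarrow>
    (nat \<Rightarrow> real) \<Rightarrow> (nat \<Rightarrow> real) \<Rightarrow> complex" where
  "step_kernel p N a \<alpha> k x =
     (\<Sum>(i, m) \<in> multi_indices p {1..N} \<times> multi_indices p \<alpha>.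
        of_nat p ^ card \<alpha> * a (\<alpha>, i, m) *
        (\<Prod>j\<in>{1..N}. step p (i j) (k j)) * (\<Prod>n\<in>\<alpha>. step p (m n) (x n)))"

text \<open>
  The library's \<open>merge \<alpha> \<beta> (x, y)\<close> is \<open>x\<^sub>\<alpha> \<diamond> y\<^sub>\<beta>\<close>. For \<open>\<alpha> = {}\<close> the summand below is
  \<open>step_kernel p N a {} k undefined * u k\<close>, where the kernel does not depend on its last
  argument.
\<close>

definition mixed_integral :: "nat \<Rightarrow> nat \<Rightarrow> coefficients \<Rightarrow>
    ((nat \<Rightarrow> real) \<Rightarrow> complex) \<Rightarrow> (nat \<Rightarrow> real) \<Rightarrow> complex" where
  "mixed_integral p N a u k =
     (\<Sum>\<alpha>\<in>Pow {1..N}. \<integral>x. step_kernel p N a \<alpha> k x * u (merge ({1..N} - \<alpha>) \<alpha> (k, x)) \<partial>cube \<alpha>)"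

type_synonym L2_operator =
  "((nat \<Rightarrow> real) \<Rightarrow> complex) set \<Rightarrow> ((nat \<Rightarrow> real) \<Rightarrow> complex) set"

definition mixed_op :: "nat \<Rightarrow> nat \<Rightarrow> coefficients \<Rightarrow> L2_operator" where
  "mixed_op p N a = (\<lambda>U\<in>L2 N. \<Union>u\<in>U. ae_equal N `` {mixed_integral p N a u})"

definition mixed_algebra :: "nat \<Rightarrow> nat \<Rightarrow> (complex, L2_operator) module" where
  "mixed_algebra p N =
     \<lparr>carrier = mixed_op p N ` coefficient_families p N,
      mult = (\<lambda>A B. compose (L2 N) A B),
      one = (\<lambda>U\<in>L2 N. U),
      zero = (\<lambda>U\<in>L2 N. L2_zero N),
      add = (\<lambda>A B. \<lambda>U\<in>L2 N. L2_add N (A U) (B U)),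
      smult = (\<lambda>c A. \<lambda>U\<in>L2 N. L2_scale N c (A U))\<rparr>"


section \<open>The map \<open>\<sigma>\<close>\<close>

definition coefficients_of :: "nat \<Rightarrow> nat \<Rightarrow> L2_operator \<Rightarrow> coefficients" where
  "coefficients_of p N A = (THE a. a \<in> coefficient_families p N \<and> A = mixed_op p N a)"

definition b_coeff :: "coefficients \<Rightarrow> nat set \<Rightarrow> (nat \<Rightarrow> nat) \<Rightarrow> (nat \<Rightarrow> nat) \<Rightarrow> complex" where
  "b_coeff a \<alpha> i m =
     (\<Sum>\<beta>\<in>Pow \<alpha>. of_bool (restrict i (\<alpha> - \<beta>) = restrict m (\<alpha> - \<beta>)) * a (\<beta>, i, restrict m \<beta>))"

definition B_matrix :: "nat \<Rightarrow> nat \<Rightarrow> coefficients \<Rightarrow> nat set \<Rightarrow> (nat \<Rightarrow> nat) \<Rightarrow>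
    (nat \<Rightarrow> nat) \<times> (nat \<Rightarrow> nat) \<Rightarrow> complex" where
  "B_matrix p N a \<alpha> i =
     (\<lambda>(m, n)\<in>multi_indices p \<alpha> \<times> multi_indices p \<alpha>.
        b_coeff a \<alpha> (merge ({1..N} - \<alpha>) \<alpha> (i, m)) n)"

definition sigma_map :: "nat \<Rightarrow> nat \<Rightarrow> L2_operator \<Rightarrow>
    nat set \<Rightarrow> (nat \<Rightarrow> nat) \<Rightarrow> (nat \<Rightarrow> nat) \<times> (nat \<Rightarrow> nat) \<Rightarrow> complex" where
  "sigma_map p N A =
     (\<lambda>\<alpha>\<in>Pow {1..N}. \<lambda>i\<in>multi_indices p ({1..N} - \<alpha>). B_matrix p N (coefficients_of p N A) \<alpha> i)"

definition sigma_target :: "nat \<Rightarrow> nat \<Rightarrow>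
    (complex, nat set \<Rightarrow> (nat \<Rightarrow> nat) \<Rightarrow> (nat \<Rightarrow> nat) \<times> (nat \<Rightarrow> nat) \<Rightarrow> complex) module" where
  "sigma_target p N =
     product_algebra (Pow {1..N}) (\<lambda>\<alpha>.
       product_algebra (multi_indices p ({1..N} - \<alpha>)) (\<lambda>i. matrix_algebra (multi_indices p \<alpha>)))"

definition block_algebra :: "nat \<Rightarrow> nat \<Rightarrow>
    (complex, nat \<Rightarrow> nat \<Rightarrow> nat \<times> nat \<Rightarrow> complex) module" where
  "block_algebra p N =
     product_algebra {0..N} (\<lambda>n.
       product_algebra {1..(N choose n) * p ^ (N - n)} (\<lambda>j. matrix_algebra {1..p ^ n}))"

end

theory Submission
  imports Defs
begin

text \<open>
  Averaging over the coordinates in \<open>\<alpha>\<close>, weighted by the indicator of a cell, is the elementary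
  operator behind the integral terms. By Fubini's theorem two such averages compose to an average over
  the union of their coordinate sets, so mixed operators are closed under composition; the
  coefficients of the product are never needed. For \<open>\<gamma> \<subseteq> \<eta>\<close> consider the functions that are constant
  on cells up to a factor \<open>\<Prod>\<^sub>n h(k\<^sub>n)\<close>, \<open>n \<notin> \<gamma>\<close>, where \<open>h = 1\<close> on the left and \<open>h = -1\<close> on the
  right half of every cell. As \<open>h\<close> has mean zero on cells, only the terms with \<open>\<alpha> \<subseteq> \<gamma>\<close> survive on them,
  and \<open>\<A>\<close> acts on this finite-dimensional invariant space through the matrices \<open>B\<^sub>\<gamma>(i)\<close>.
  This yields at once that the operator determines all \<open>b\<^sub>\<gamma>\<close> and that \<open>\<sigma>\<close> is multiplicative. The system
  defining \<open>b\<close> from \<open>a\<close> is triangular with respect to inclusion, hence \<open>\<sigma>\<close> is bijective.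
\<close>

section \<open>Algebras\<close>

text \<open>The delta in \<open>b_coeff\<close> is the entry of an identity matrix: on functions of
  the cell alone, the term of \<beta> \<subseteq> \<gamma> moves only the coordinates in \<beta>, so
  as a matrix over the multi-indices on \<gamma> it is the identity in the other coordinates. Thus b
  collects all terms that act within \<gamma>. The factor \<open>p ^ card \<alpha>\<close> is the
  reciprocal volume of a cell in the \<alpha> coordinates; it makes every integral term a
  combination of averages over probability measures, and so averages compose without extra
  constants. Functions constant on cells see only the block of \<gamma> = \<eta>; the smaller blocks
  become visible only on functions that averaging in the other coordinates annihilates. The delicate
  point is that slices of a square-integrable function are integrable only for almost every point,
  so linearity and Fubini hold almost everywhere rather than at every point. The way back from such
  identities to coefficients is open because each cell has positive measure.\<close>

lemma complex_field_simps [simp]: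
  "carrier complex_field = UNIV" "c \<otimes>\<^bsub>complex_field\<^esub> d = c * d"
  "c \<oplus>\<^bsub>complex_field\<^esub> d = c + d" "\<one>\<^bsub>complex_field\<^esub> = 1" "\<zero>\<^bsub>complex_field\<^esub> = 0"
  by (simp_all add: complex_field_def)

lemma cring_complex_field: "cring complex_field"
proof (rule cringI)
  show "abelian_group complex_field"
  proof (rule abelian_groupI)
    fix x :: complex
    show "\<exists>y\<in>carrier complex_field. y \<oplus>\<^bsub>complex_field\<^esub> x = \<zero>\<^bsub>complex_field\<^esub>"
      by (rule bexI[of _ "- x"]) simp_all
  qed simp_all
  show "comm_monoid complex_field"
    by (rule comm_monoidI) simp_all
qed (simp add: distrib_right)

lemma unital_algebraI:
  assumes "cring R" "abelian_group A" "monoid A"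
    and "\<And>x y z. \<lbrakk>x \<in> carrier A; y \<in> carrier A; z \<in> carrier A\<rbrakk> \<Longrightarrow>
           (x \<oplus>\<^bsub>A\<^esub> y) \<otimes>\<^bsub>A\<^esub> z = x \<otimes>\<^bsub>A\<^esub> z \<oplus>\<^bsub>A\<^esub> y \<otimes>\<^bsub>A\<^esub> z"
    and "\<And>x y z. \<lbrakk>x \<in> carrier A; y \<in> carrier A; z \<in> carrier A\<rbrakk> \<Longrightarrow>
           z \<otimes>\<^bsub>A\<^esub> (x \<oplus>\<^bsub>A\<^esub> y) = z \<otimes>\<^bsub>A\<^esub> x \<oplus>\<^bsub>A\<^esub> z \<otimes>\<^bsub>A\<^esub> y"
    and "\<And>c x. \<lbrakk>c \<in> carrier R; x \<in> carrier A\<rbrakk> \<Longrightarrow> c \<odot>\<^bsub>A\<^esub> x \<in> carrier A"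
    and "\<And>c d x. \<lbrakk>c \<in> carrier R; d \<in> carrier R; x \<in> carrier A\<rbrakk> \<Longrightarrow>
           (c \<oplus>\<^bsub>R\<^esub> d) \<odot>\<^bsub>A\<^esub> x = c \<odot>\<^bsub>A\<^esub> x \<oplus>\<^bsub>A\<^esub> d \<odot>\<^bsub>A\<^esub> x"
    and "\<And>c x y. \<lbrakk>c \<in> carrier R; x \<in> carrier A; y \<in> carrier A\<rbrakk> \<Longrightarrow>
           c \<odot>\<^bsub>A\<^esub> (x \<oplus>\<^bsub>A\<^esub> y) = c \<odot>\<^bsub>A\<^esub> x \<oplus>\<^bsub>A\<^esub> c \<odot>\<^bsub>A\<^esub> y"
    and "\<And>c d x. \<lbrakk>c \<in> carrier R; d \<in> carrier R; x \<in> carrier A\<rbrakk> \<Longrightarrow>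
           (c \<otimes>\<^bsub>R\<^esub> d) \<odot>\<^bsub>A\<^esub> x = c \<odot>\<^bsub>A\<^esub> (d \<odot>\<^bsub>A\<^esub> x)"
    and "\<And>x. x \<in> carrier A \<Longrightarrow> \<one>\<^bsub>R\<^esub> \<odot>\<^bsub>A\<^esub> x = x"
    and "\<And>c x y. \<lbrakk>c \<in> carrier R; x \<in> carrier A; y \<in> carrier A\<rbrakk> \<Longrightarrow>
           (c \<odot>\<^bsub>A\<^esub> x) \<otimes>\<^bsub>A\<^esub> y = c \<odot>\<^bsub>A\<^esub> (x \<otimes>\<^bsub>A\<^esub> y)"
    and "\<And>c x y. \<lbrakk>c \<in> carrier R; x \<in> carrier A; y \<in> carrier A\<rbrakk> \<Longrightarrow>
           x \<otimes>\<^bsub>A\<^esub> (c \<odot>\<^bsub>A\<^esub> y) = c \<odot>\<^bsub>A\<^esub> (x \<otimes>\<^bsub>A\<^esub> y)"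
  shows "unital_algebra R A"
  unfolding unital_algebra_def by (intro conjI ballI moduleI ringI assms)

lemma unital_algebraD:
  assumes "unital_algebra R A"
  shows "module R A" "ring A" "cring R" "abelian_group A" "monoid A"
    "\<And>c x y. \<lbrakk>c \<in> carrier R; x \<in> carrier A; y \<in> carrier A\<rbrakk> \<Longrightarrow>
       (c \<odot>\<^bsub>A\<^esub> x) \<otimes>\<^bsub>A\<^esub> y = c \<odot>\<^bsub>A\<^esub> (x \<otimes>\<^bsub>A\<^esub> y)"
    "\<And>c x y. \<lbrakk>c \<in> carrier R; x \<in> carrier A; y \<in> carrier A\<rbrakk> \<Longrightarrow>
       x \<otimes>\<^bsub>A\<^esub> (c \<odot>\<^bsub>A\<^esub> y) = c \<odot>\<^bsub>A\<^esub> (x \<otimes>\<^bsub>A\<^esub> y)"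
  using assms unfolding unital_algebra_def module_def ring_def by blast+

section \<open>Product algebras and matrix algebras\<close>

lemma product_algebra_simps [simp]:
  "carrier (product_algebra I A) = (\<Pi>\<^sub>E i\<in>I. carrier (A i))"
  "x \<otimes>\<^bsub>product_algebra I A\<^esub> y = (\<lambda>i\<in>I. x i \<otimes>\<^bsub>A i\<^esub> y i)"
  "x \<oplus>\<^bsub>product_algebra I A\<^esub> y = (\<lambda>i\<in>I. x i \<oplus>\<^bsub>A i\<^esub> y i)"
  "c \<odot>\<^bsub>product_algebra I A\<^esub> x = (\<lambda>i\<in>I. c \<odot>\<^bsub>A i\<^esub> x i)"
  "\<one>\<^bsub>product_algebra I A\<^esub> = (\<lambda>i\<in>I. \<one>\<^bsub>A i\<^esub>)"
  "\<zero>\<^bsub>product_algebra I A\<^esub> = (\<lambda>i\<in>I. \<zero>\<^bsub>A i\<^esub>)"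
  by (simp_all add: product_algebra_def)

lemma matrix_algebra_simps [simp]:
  "carrier (matrix_algebra I) = I \<times> I \<rightarrow>\<^sub>E UNIV"
  "X \<otimes>\<^bsub>matrix_algebra I\<^esub> Y = (\<lambda>(m, n)\<in>I \<times> I. \<Sum>l\<in>I. X (m, l) * Y (l, n))"
  "X \<oplus>\<^bsub>matrix_algebra I\<^esub> Y = (\<lambda>(m, n)\<in>I \<times> I. X (m, n) + Y (m, n))"
  "c \<odot>\<^bsub>matrix_algebra I\<^esub> X = (\<lambda>(m, n)\<in>I \<times> I. c * X (m, n))"
  "\<one>\<^bsub>matrix_algebra I\<^esub> = (\<lambda>(m, n)\<in>I \<times> I. of_bool (m = n))"
  "\<zero>\<^bsub>matrix_algebra I\<^esub> = (\<lambda>(m, n)\<in>I \<times> I. 0)"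
  by (simp_all add: matrix_algebra_def)

lemma unital_algebra_product:
  assumes "cring R" and A: "\<And>i. i \<in> I \<Longrightarrow> unital_algebra R (A i)"
  shows "unital_algebra R (product_algebra I A)"
proof -
  note md = A[THEN unital_algebraD(1)]
  note ag = A[THEN unital_algebraD(4)]
  note mn = A[THEN unital_algebraD(5)]
  note rg = A[THEN unital_algebraD(2)]
  have mem [simp]: "x i \<in> carrier (A i)" if "x \<in> (\<Pi>\<^sub>E i\<in>I. carrier (A i))" "i \<in> I" for x i
    using that by (rule PiE_mem)
  have [simp]: "x \<in> extensional I" if "x \<in> (\<Pi>\<^sub>E i\<in>I. carrier (A i))" for x
    using that by (simp add: PiE_def)
  note [simp] = abelian_groupE(1)[OF ag] abelian_groupE(2)[OF ag] monoid.m_closed[OF mn]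
    monoid.one_closed[OF mn] module.smult_closed[OF md]
    abelian_group.a_inv_closed[OF ag] abelian_group.l_neg[OF ag] abelian_groupE(5)[OF ag]
    monoid.l_one[OF mn] monoid.r_one[OF mn]
  have mem': "restrict f I \<in> (\<Pi>\<^sub>E i\<in>I. carrier (A i))" if "\<And>i. i \<in> I \<Longrightarrow> f i \<in> carrier (A i)" for f
    using that by (intro restrict_PiE_iff[THEN iffD2]) blast
  note eqI = extensionalityI[where A = I]
  have abg: "abelian_group (product_algebra I A)"
  proof (rule abelian_groupI)
    fix x assume x: "x \<in> carrier (product_algebra I A)"
    let ?y = "\<lambda>i\<in>I. \<ominus>\<^bsub>A i\<^esub> x i"
    have "?y \<in> carrier (product_algebra I A)"
      using x by (simp add: mem')
    moreover have "?y \<oplus>\<^bsub>product_algebra I A\<^esub> x = \<zero>\<^bsub>product_algebra I A\<^esub>"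
      by (rule eqI) (use x in simp_all)
    ultimately show "\<exists>y\<in>carrier (product_algebra I A). y \<oplus>\<^bsub>product_algebra I A\<^esub> x = \<zero>\<^bsub>product_algebra I A\<^esub>"
      by blast
  next
    fix x y assume "x \<in> carrier (product_algebra I A)" "y \<in> carrier (product_algebra I A)"
    then show "x \<oplus>\<^bsub>product_algebra I A\<^esub> y = y \<oplus>\<^bsub>product_algebra I A\<^esub> x"
      by (intro eqI) (simp_all add: abelian_groupE(4)[OF ag])
  qed (simp add: mem' | rule eqI; simp add: abelian_groupE(3)[OF ag])+
  have mon: "monoid (product_algebra I A)"
    by (rule monoidI; (simp add: mem')?; (rule eqI)?; simp add: monoid.m_assoc[OF mn])
  show ?thesis
    \<comment> \<open>Membership goals end with \<open>mem'\<close> and equations become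
      componentwise by \<open>eqI\<close>; entries 13 and 23 of \<open>ring_simprules\<close> are
      the two distributive laws.\<close>
    by (rule unital_algebraI[OF assms(1) abg mon]; (rule mem' eqI | simp only: product_algebra_simps)+;
       simp add: ring.ring_simprules(13,23)[OF rg]
        module.smult_l_distr[OF md] module.smult_r_distr[OF md] module.smult_assoc1[OF md]
        module.smult_one[OF md] unital_algebraD(6,7)[OF A])
qed

text \<open>Entries are arbitrary complex numbers, so membership is extensionality and nothing else;
  whatever \<open>restrict\<close> produces on \<open>I \<times> I\<close> qualifies at
  once.\<close>

lemma carrier_matrix_algebra: "carrier (matrix_algebra I) = extensional (I \<times> I)"
  by (auto simp: PiE_def)

lemma matrix_eqI:
  assumes "X \<in> extensional (I \<times> I)" "Y \<in> extensional (I \<times> I)"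
    and "\<And>m n. \<lbrakk>m \<in> I; n \<in> I\<rbrakk> \<Longrightarrow> X (m, n) = Y (m, n)"
  shows "X = Y"
  using assms by (intro extensionalityI[of X "I \<times> I" Y]) auto

lemma sum_of_bool_eq:
  fixes f :: "'a \<Rightarrow> 'b :: comm_semiring_1"
  assumes "finite I" "j \<in> I"
  shows "(\<Sum>i\<in>I. of_bool (j = i) * f i) = f j" "(\<Sum>i\<in>I. f i * of_bool (i = j)) = f j"
  using assms by (simp_all add: sum.remove sum.neutral)

lemma unital_algebra_matrix:
  assumes [simp]: "finite I"
  shows "unital_algebra complex_field (matrix_algebra I)"
proof -
  note [simp] = carrier_matrix_algebra and [simp del] = matrix_algebra_simps(1)
  note [cong] = sum.cong
  have abg: "abelian_group (matrix_algebra I)"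
  proof (rule abelian_groupI)
    fix X assume X: "X \<in> carrier (matrix_algebra I)"
    show "\<exists>Y\<in>carrier (matrix_algebra I). Y \<oplus>\<^bsub>matrix_algebra I\<^esub> X = \<zero>\<^bsub>matrix_algebra I\<^esub>"
      by (rule bexI[of _ "\<lambda>(m,n)\<in>I\<times>I. - X (m,n)"]; simp; intro matrix_eqI[where I = I]; simp)
  qed (simp; intro matrix_eqI[where I = I]; simp)+
  have mon: "monoid (matrix_algebra I)"
  proof (rule monoidI)
    fix X Y Z :: "'a \<times> 'a \<Rightarrow> complex"
    have "(\<Sum>l\<in>I. (\<Sum>k\<in>I. X (m,k) * Y (k,l)) * Z (l,n)) = (\<Sum>k\<in>I. X (m,k) * (\<Sum>l\<in>I. Y (k,l) * Z (l,n)))"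
      for m n
      by (simp add: sum_distrib_left sum_distrib_right mult.assoc) (rule sum.swap)
    then show "X \<otimes>\<^bsub>matrix_algebra I\<^esub> Y \<otimes>\<^bsub>matrix_algebra I\<^esub> Z =
        X \<otimes>\<^bsub>matrix_algebra I\<^esub> (Y \<otimes>\<^bsub>matrix_algebra I\<^esub> Z)"
      by (intro matrix_eqI[where I = I]) simp_all
  next
    fix X assume "X \<in> carrier (matrix_algebra I)"
    then show "\<one>\<^bsub>matrix_algebra I\<^esub> \<otimes>\<^bsub>matrix_algebra I\<^esub> X = X"
       "X \<otimes>\<^bsub>matrix_algebra I\<^esub> \<one>\<^bsub>matrix_algebra I\<^esub> = X"
      by (intro matrix_eqI[where I = I]; simp add: sum_of_bool_eq)+
  qed simp_all
  show ?thesis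
    by (rule unital_algebraI[OF cring_complex_field abg mon];
       (intro matrix_eqI[where I = I])?; simp add: algebra_simps sum.distrib sum_distrib_left)
qed

text \<open>
  Only the target is assumed to be an algebra: the axioms of the source are pulled back along
  the injection \<open>f\<close>.
\<close>

lemma algebra_isomorphism_pullback:
  assumes B: "unital_algebra R B" and f: "bij_betw f (carrier A) (carrier B)"
    and m: "\<And>x y. \<lbrakk>x \<in> carrier A; y \<in> carrier A\<rbrakk> \<Longrightarrow>
           x \<otimes>\<^bsub>A\<^esub> y \<in> carrier A \<and> f (x \<otimes>\<^bsub>A\<^esub> y) = f x \<otimes>\<^bsub>B\<^esub> f y"
    and a: "\<And>x y. \<lbrakk>x \<in> carrier A; y \<in> carrier A\<rbrakk> \<Longrightarrow>
           x \<oplus>\<^bsub>A\<^esub> y \<in> carrier A \<and> f (x \<oplus>\<^bsub>A\<^esub> y) = f x \<oplus>\<^bsub>B\<^esub> f y"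
    and s: "\<And>c x. \<lbrakk>c \<in> carrier R; x \<in> carrier A\<rbrakk> \<Longrightarrow>
           c \<odot>\<^bsub>A\<^esub> x \<in> carrier A \<and> f (c \<odot>\<^bsub>A\<^esub> x) = c \<odot>\<^bsub>B\<^esub> f x"
    and o: "\<one>\<^bsub>A\<^esub> \<in> carrier A" "f \<one>\<^bsub>A\<^esub> = \<one>\<^bsub>B\<^esub>"
    and z: "\<zero>\<^bsub>A\<^esub> \<in> carrier A" "f \<zero>\<^bsub>A\<^esub> = \<zero>\<^bsub>B\<^esub>"
  shows "algebra_isomorphism R A B f"
proof -
  note B' = unital_algebraD[OF B]
  interpret BR: ring B by (rule B')
  interpret B: module R B by (rule B')
  have inj: "x = y" if "x \<in> carrier A" "y \<in> carrier A" "f x = f y" for x y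
    using f that by (auto simp: bij_betw_def inj_on_def)
  have fc: "f x \<in> carrier B" if "x \<in> carrier A" for x
    using f that by (auto simp: bij_betw_def)
  note [simp] = fc m[THEN conjunct1] m[THEN conjunct2] a[THEN conjunct1] a[THEN conjunct2]
    s[THEN conjunct1] s[THEN conjunct2] o z
  have abg: "abelian_group A"
  proof (rule abelian_groupI)
    fix x assume x: "x \<in> carrier A"
    obtain y where y: "y \<in> carrier A" "f y = \<ominus>\<^bsub>B\<^esub> f x"
      using f fc[OF x] by (metis BR.a_inv_closed bij_betw_def imageE)
    then have "y \<oplus>\<^bsub>A\<^esub> x = \<zero>\<^bsub>A\<^esub>"
      using x by (intro inj) (simp_all add: BR.l_neg)
    with y show "\<exists>y\<in>carrier A. y \<oplus>\<^bsub>A\<^esub> x = \<zero>\<^bsub>A\<^esub>" by blast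
  qed ((rule inj)?; simp add: BR.a_ac)+
  have mon: "monoid A"
    by (rule monoidI; (rule inj)?; simp add: BR.m_assoc)
  have "unital_algebra R A"
    by (rule unital_algebraI[OF B'(3) abg mon]; (rule inj)?;
       simp add: BR.l_distr BR.r_distr B.smult_l_distr B.smult_r_distr B.smult_assoc1 B'(6,7))
  then show ?thesis
    using B f m a s o fc unfolding algebra_isomorphism_def
    by (auto simp: ring_iso_def ring_hom_def)
qed

section \<open>Counting multi-indices and regrouping the blocks by size\<close>

lemma finite_multi_indices [simp]: "finite \<alpha> \<Longrightarrow> finite (multi_indices p \<alpha>)"
  by (simp add: multi_indices_def finite_PiE)

lemma card_multi_indices: "finite \<alpha> \<Longrightarrow> card (multi_indices p \<alpha>) = p ^ card \<alpha>"
  by (simp add: multi_indices_def card_PiE)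

lemma unital_algebra_sigma_target: "unital_algebra complex_field (sigma_target p N)"
  unfolding sigma_target_def
  by (intro unital_algebra_product unital_algebra_matrix cring_complex_field)
    (auto intro: finite_multi_indices finite_subset)

lemma unital_algebra_block_algebra: "unital_algebra complex_field (block_algebra p N)"
  unfolding block_algebra_def
  by (intro unital_algebra_product unital_algebra_matrix cring_complex_field) simp

text \<open>Choosing \<alpha> with n elements and then a multi-index on its complement leaves
  \<open>(N choose n) * p ^ (N - n)\<close> possibilities, so collecting blocks of equal size is a
  relabelling. Inside a block one enumeration \<open>\<psi> \<alpha>\<close> serves rows and columns
  alike, which is what preserves products.\<close>

lemma ex_algebra_isomorphism_sigma_target_block_algebra:
  "\<exists>\<tau>. algebra_isomorphism complex_field (sigma_target p N) (block_algebra p N) \<tau>"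
proof -
  let ?P = "multi_indices p" and ?E = "{1..N}"
  let ?J = "\<lambda>n. {1..(N choose n) * p ^ (N - n)}"
  \<comment> \<open>\<open>S n\<close> indexes all blocks with \<open>p ^ n\<close> rows.\<close>
  define S where "S n = (SIGMA \<alpha>:{\<alpha>. \<alpha> \<subseteq> ?E \<and> card \<alpha> = n}. ?P (?E - \<alpha>))" for n
  have fin: "finite \<alpha>" if "\<alpha> \<subseteq> ?E" for \<alpha>
    using that by (rule finite_subset) simp
  have "card (S n) = (N choose n) * p ^ (N - n)" for n
    unfolding S_def by (subst card_SigmaI)
      (auto simp: card_multi_indices card_Diff_subset fin n_subsets)
  then have "\<exists>f. bij_betw f (?J n) (S n)" for n
    by (intro finite_same_card_bij) (auto simp: S_def fin intro!: finite_SigmaI)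
  then obtain \<phi> where \<phi>: "\<And>n. bij_betw (\<phi> n) (?J n) (S n)"
    by metis
  have "\<exists>f. bij_betw f {1..p ^ card \<alpha>} (?P \<alpha>)" if "\<alpha> \<in> Pow ?E" for \<alpha>
    using that by (intro finite_same_card_bij) (auto simp: fin card_multi_indices)
  then obtain \<psi> where \<psi>: "\<And>\<alpha>. \<alpha> \<in> Pow ?E \<Longrightarrow> bij_betw (\<psi> \<alpha>) {1..p ^ card \<alpha>} (?P \<alpha>)"
    by metis
  define \<phi>' where "\<phi>' n = inv_into (?J n) (\<phi> n)" for n
  define \<psi>' where "\<psi>' \<alpha> = inv_into {1..p ^ card \<alpha>} (\<psi> \<alpha>)" for \<alpha>
  have \<phi>_mem: "\<phi> n j \<in> S n" if "j \<in> ?J n" for n j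
    using \<phi> that by (rule bij_betwE[THEN bspec])
  have \<phi>_cases: "fst (\<phi> n j) \<in> Pow ?E \<and> card (fst (\<phi> n j)) = n \<and> snd (\<phi> n j) \<in> ?P (?E - fst (\<phi> n j))"
    if "j \<in> ?J n" for n j
    using \<phi>_mem[OF that] by (auto simp: S_def)
  have \<phi>'_mem: "\<phi>' n x \<in> ?J n" "\<phi> n (\<phi>' n x) = x" if "x \<in> S n" for n x
    using bij_betwE[OF bij_betw_inv_into[OF \<phi>]] that bij_betw_inv_into_right[OF \<phi>]
    unfolding \<phi>'_def by blast+
  have \<phi>'_\<phi>: "\<phi>' n (\<phi> n j) = j" if "j \<in> ?J n" for n j
    using bij_betw_inv_into_left[OF \<phi>] that unfolding \<phi>'_def by blast
  have \<psi>_mem: "\<psi> \<alpha> a \<in> ?P \<alpha>" if "\<alpha> \<in> Pow ?E" "a \<in> {1..p ^ card \<alpha>}" for \<alpha> a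
    using \<psi> that by (metis bij_betwE)
  have \<psi>'_mem: "\<psi>' \<alpha> m \<in> {1..p ^ card \<alpha>}" "\<psi> \<alpha> (\<psi>' \<alpha> m) = m" if "\<alpha> \<in> Pow ?E" "m \<in> ?P \<alpha>" for \<alpha> m
    using bij_betwE[OF bij_betw_inv_into[OF \<psi>]] that bij_betw_inv_into_right[OF \<psi>]
    unfolding \<psi>'_def by blast+
  have \<psi>'_\<psi>: "\<psi>' \<alpha> (\<psi> \<alpha> a) = a" if "\<alpha> \<in> Pow ?E" "a \<in> {1..p ^ card \<alpha>}" for \<alpha> a
    using bij_betw_inv_into_left[OF \<psi>] that unfolding \<psi>'_def by blast
  have mem_S: "(\<alpha>, i) \<in> S (card \<alpha>)" if "\<alpha> \<in> Pow ?E" "i \<in> ?P (?E - \<alpha>)" for \<alpha> i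
    using that by (auto simp: S_def)
  have card_le: "card \<alpha> \<in> {0..N}" if "\<alpha> \<in> Pow ?E" for \<alpha>
    using that card_mono[of ?E \<alpha>] by auto
  define \<tau> :: "(nat set \<Rightarrow> (nat \<Rightarrow> nat) \<Rightarrow> (nat \<Rightarrow> nat) \<times> (nat \<Rightarrow> nat) \<Rightarrow> complex) \<Rightarrow>
      nat \<Rightarrow> nat \<Rightarrow> nat \<times> nat \<Rightarrow> complex"
    where "\<tau> = (\<lambda>X. \<lambda>n\<in>{0..N}. \<lambda>j\<in>?J n. \<lambda>(a, b)\<in>{1..p ^ n} \<times> {1..p ^ n}.
       X (fst (\<phi> n j)) (snd (\<phi> n j)) (\<psi> (fst (\<phi> n j)) a, \<psi> (fst (\<phi> n j)) b))"
  define \<tau>' :: "(nat \<Rightarrow> nat \<Rightarrow> nat \<times> nat \<Rightarrow> complex) \<Rightarrow>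
      nat set \<Rightarrow> (nat \<Rightarrow> nat) \<Rightarrow> (nat \<Rightarrow> nat) \<times> (nat \<Rightarrow> nat) \<Rightarrow> complex"
    where "\<tau>' = (\<lambda>Y. \<lambda>\<alpha>\<in>Pow ?E. \<lambda>i\<in>?P (?E - \<alpha>). \<lambda>(m, l)\<in>?P \<alpha> \<times> ?P \<alpha>.
       Y (card \<alpha>) (\<phi>' (card \<alpha>) (\<alpha>, i)) (\<psi>' \<alpha> m, \<psi>' \<alpha> l))"
  let ?A = "sigma_target p N" and ?B = "block_algebra p N"
  have \<tau>_carrier: "\<tau> X \<in> carrier ?B" for X
    unfolding \<tau>_def block_algebra_def
    by (simp del: PiE_UNIV_domain restrict_PiE_iff add: carrier_matrix_algebra PiE_I)
  have \<tau>'_carrier: "\<tau>' Y \<in> carrier ?A" for Y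
    unfolding \<tau>'_def sigma_target_def
    by (simp add: carrier_matrix_algebra PiE_I)
  have \<tau>'_\<tau>: "\<tau>' (\<tau> X) = X" if "X \<in> carrier ?A" for X
  proof (rule extensionalityI[where A = "Pow ?E"])
    have X: "X \<in> (\<Pi>\<^sub>E \<alpha>\<in>Pow ?E. \<Pi>\<^sub>E i\<in>?P (?E - \<alpha>). extensional (?P \<alpha> \<times> ?P \<alpha>))"
      using that by (simp only: sigma_target_def product_algebra_simps carrier_matrix_algebra)
    then show "X \<in> extensional (Pow ?E)" by (simp add: PiE_def)
    fix \<alpha> assume \<alpha>: "\<alpha> \<in> Pow ?E"
    note X\<alpha> = PiE_mem[OF X \<alpha>]
    show "\<tau>' (\<tau> X) \<alpha> = X \<alpha>"
    proof (rule extensionalityI[where A = "?P (?E - \<alpha>)"])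
      show "X \<alpha> \<in> extensional (?P (?E - \<alpha>))" using X\<alpha> by (simp add: PiE_def)
      show "\<tau>' (\<tau> X) \<alpha> \<in> extensional (?P (?E - \<alpha>))" using \<alpha> by (simp only: \<tau>'_def restrict_apply' restrict_extensional)
      fix i assume i: "i \<in> ?P (?E - \<alpha>)"
      show "\<tau>' (\<tau> X) \<alpha> i = X \<alpha> i"
        using \<alpha> i PiE_mem[OF X\<alpha> i] card_le[OF \<alpha>] \<phi>'_mem[OF mem_S[OF \<alpha> i]] 
        by (intro matrix_eqI[where I = "?P \<alpha>"])
          (simp_all only: \<tau>'_def \<tau>_def restrict_apply' restrict_extensional \<psi>'_mem fst_conv snd_conv mem_Sigma_iff case_prod_conv simp_thms)
    qed
  qed (simp add: \<tau>'_def)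
  have \<tau>_\<tau>': "\<tau> (\<tau>' Y) = Y" if "Y \<in> carrier ?B" for Y
  proof (rule extensionalityI[where A = "{0..N}"])
    have Y: "Y \<in> (\<Pi>\<^sub>E n\<in>{0..N}. \<Pi>\<^sub>E j\<in>?J n. extensional ({1..p ^ n} \<times> {1..p ^ n}))"
      using that by (simp only: block_algebra_def product_algebra_simps carrier_matrix_algebra)
    then show "Y \<in> extensional {0..N}" by (simp add: PiE_def)
    fix n assume n: "n \<in> {0..N}"
    note Yn = PiE_mem[OF Y n]
    show "\<tau> (\<tau>' Y) n = Y n"
    proof (rule extensionalityI[where A = "?J n"])
      show "Y n \<in> extensional (?J n)" using Yn by (simp add: PiE_def)
      show "\<tau> (\<tau>' Y) n \<in> extensional (?J n)" using n by (simp only: \<tau>_def restrict_apply' restrict_extensional)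
      fix j assume j: "j \<in> ?J n"
      note \<alpha> = \<phi>_cases[OF j]
      have m: "\<psi> (fst (\<phi> n j)) a \<in> ?P (fst (\<phi> n j))" "\<psi>' (fst (\<phi> n j)) (\<psi> (fst (\<phi> n j)) a) = a"
        if "a \<in> {1..p ^ n}" for a
        using \<psi>_mem \<psi>'_\<psi> \<alpha> that by auto
      show "\<tau> (\<tau>' Y) n j = Y n j"
        using n j PiE_mem[OF Yn j] \<alpha> \<phi>'_\<phi>[OF j] m
        by (intro matrix_eqI[where I = "{1..p ^ n}"])
          (simp_all only: \<tau>'_def \<tau>_def restrict_apply' restrict_extensional fst_conv snd_conv mem_Sigma_iff case_prod_conv simp_thms prod.collapse)
    qed
  qed (simp add: \<tau>_def)
  have bij: "bij_betw \<tau> (carrier ?A) (carrier ?B)"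
    by (rule bij_betw_byWitness[where f' = \<tau>'])
      (use \<tau>_\<tau>' \<tau>'_\<tau> \<tau>_carrier \<tau>'_carrier in auto)
  have m: "\<tau> (X \<otimes>\<^bsub>?A\<^esub> Y) = \<tau> X \<otimes>\<^bsub>?B\<^esub> \<tau> Y" for X Y
  proof -
    \<comment> \<open>One product sums over multi-indices, the other over numbers; the enumeration
      of the rows reindexes the sum.\<close>
    have "(\<Sum>l\<in>?P \<alpha>. f l) = (\<Sum>a\<in>{1..p ^ card \<alpha>}. f (\<psi> \<alpha> a))" if "\<alpha> \<in> Pow ?E"
      for \<alpha> and f :: "(nat \<Rightarrow> nat) \<Rightarrow> complex"
      using sum.reindex_bij_betw[OF \<psi>[OF that], of f] by (rule sym)
    then have s: "(\<Sum>l\<in>?P (fst (\<phi> n j)). f l) = (\<Sum>a\<in>{1..p ^ n}. f (\<psi> (fst (\<phi> n j)) a))"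
      if "j \<in> ?J n" for n j and f :: "(nat \<Rightarrow> nat) \<Rightarrow> complex"
      using \<phi>_cases[OF that] by metis
    show ?thesis
      unfolding \<tau>_def sigma_target_def block_algebra_def product_algebra_simps matrix_algebra_simps
      by (intro restrict_ext) 
       (use \<phi>_cases \<psi>_mem s in \<open>auto simp del: atLeastAtMost_iff One_nat_def cong: sum.cong\<close>)
  qed
  have a: "\<tau> (X \<oplus>\<^bsub>?A\<^esub> Y) = \<tau> X \<oplus>\<^bsub>?B\<^esub> \<tau> Y" for X Y
    unfolding \<tau>_def sigma_target_def block_algebra_def product_algebra_simps matrix_algebra_simps
    by (intro restrict_ext) 
       (use \<phi>_cases \<psi>_mem in \<open>auto simp del: atLeastAtMost_iff One_nat_def\<close>)
  have c: "\<tau> (c \<odot>\<^bsub>?A\<^esub> X) = c \<odot>\<^bsub>?B\<^esub> \<tau> X" for c X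
    unfolding \<tau>_def sigma_target_def block_algebra_def product_algebra_simps matrix_algebra_simps
    by (intro restrict_ext) 
       (use \<phi>_cases \<psi>_mem in \<open>auto simp del: atLeastAtMost_iff One_nat_def\<close>)
  \<comment> \<open>Injectivity of the enumeration carries the unit matrix to the unit
    matrix.\<close>
  have eq: "\<psi> (fst (\<phi> n j)) a = \<psi> (fst (\<phi> n j)) b \<longleftrightarrow> a = b"
    if "j \<in> ?J n" "a \<in> {1..p ^ n}" "b \<in> {1..p ^ n}" for n j a b
    using \<phi>_cases[OF that(1)] \<psi>'_\<psi> that by metis
  have o: "\<tau> \<one>\<^bsub>?A\<^esub> = \<one>\<^bsub>?B\<^esub>"
    unfolding \<tau>_def sigma_target_def block_algebra_def product_algebra_simps matrix_algebra_simps
    by (intro restrict_ext) 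
       (use \<phi>_cases \<psi>_mem eq in \<open>auto simp del: atLeastAtMost_iff One_nat_def\<close>)
  have "algebra_isomorphism complex_field ?A ?B \<tau>"
    unfolding algebra_isomorphism_def ring_iso_def ring_hom_def
    using unital_algebra_sigma_target unital_algebra_block_algebra bij m a c o \<tau>_carrier by blast
  then show ?thesis by blast
qed

section \<open>Resampling coordinates of the cube\<close>

lemma emeasure_unit_interval: "emeasure (restrict_space lborel {0..<1::real}) {0..<1} = 1"
  by (subst emeasure_restrict_space) auto

lemma space_unit_interval: "space (restrict_space lborel {0..<1::real}) = {0..<1}"
  by (simp add: space_restrict_space)

lemma finite_measure_unit_interval: "finite_measure (restrict_space lborel {0..<1::real})"
  by (rule finite_measureI) (simp add: space_unit_interval emeasure_unit_interval)

lemma product_sigma_finite_unit_interval: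
  "product_sigma_finite (\<lambda>_. restrict_space lborel {0..<1::real})"
  by (simp add: product_sigma_finite_def finite_measure_unit_interval finite_measure.axioms(1))

lemma space_cube: "space (cube \<gamma>) = (\<gamma> \<rightarrow>\<^sub>E {0..<1})"
  by (simp add: cube_def space_PiM space_unit_interval)

lemma emeasure_space_cube: "finite \<gamma> \<Longrightarrow> emeasure (cube \<gamma>) (space (cube \<gamma>)) = 1"
  using sets.top[of "restrict_space lborel {0..<1::real}"]
    product_sigma_finite.emeasure_PiM[OF product_sigma_finite_unit_interval,
      of \<gamma> "\<lambda>_. space (restrict_space lborel {0..<1})"]
  by (simp add: space_PiM cube_def space_unit_interval emeasure_unit_interval)

lemma finite_measure_cube: "finite \<gamma> \<Longrightarrow> finite_measure (cube \<gamma>)"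
  by (rule finite_measureI) (simp add: emeasure_space_cube)

lemma measure_space_cube: "finite \<gamma> \<Longrightarrow> measure (cube \<gamma>) (space (cube \<gamma>)) = 1"
  by (simp add: measure_def emeasure_space_cube)

lemma pair_sigma_finite_cube:
  "finite E \<Longrightarrow> finite \<alpha> \<Longrightarrow> pair_sigma_finite (cube E) (cube \<alpha>)"
  by (simp add: pair_sigma_finite_def finite_measure_cube finite_measure.axioms(1))

lemma measurable_component_cube:
  "n \<in> \<gamma> \<Longrightarrow> (\<lambda>x. x n) \<in> borel_measurable (cube \<gamma>)"
proof -
  assume "n \<in> \<gamma>"
  then have "(\<lambda>x. x n) \<in> cube \<gamma> \<rightarrow>\<^sub>M restrict_space lborel {0..<1}"
    unfolding cube_def by (rule measurable_component_singleton)
  then show ?thesis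
    by (metis measurable_restrict_space2_iff measurable_lborel1 measurable_lborel2)
qed

text \<open>Measurability of \<open>merge\<close> is known for a first argument living on
  \<open>E - \<alpha>\<close> only; restricting it there changes nothing, as \<open>merge\<close>
  reads no other coordinate of it.\<close>

lemma measurable_replace:
  assumes "\<alpha> \<subseteq> E"
  shows "merge (E - \<alpha>) \<alpha> \<in> cube E \<Otimes>\<^sub>M cube \<alpha> \<rightarrow>\<^sub>M cube E"
proof -
  have "(\<lambda>z. merge (E - \<alpha>) \<alpha> (restrict (fst z) (E - \<alpha>), snd z)) \<in> cube E \<Otimes>\<^sub>M cube \<alpha> \<rightarrow>\<^sub>M cube (E - \<alpha> \<union> \<alpha>)"
    unfolding cube_def by measurable
  moreover have "merge (E - \<alpha>) \<alpha> (restrict (fst z) (E - \<alpha>), snd z) = merge (E - \<alpha>) \<alpha> z" for z :: "_ \<times> (_ \<Rightarrow> real)"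
    by (cases z) (simp add: merge_def fun_eq_iff)
  moreover have "E - \<alpha> \<union> \<alpha> = E" using assms by auto
  ultimately show ?thesis by simp
qed

text \<open>Replacing some of N independent uniform coordinates by fresh independent uniform ones
  gives again a uniform point. It suffices to compare boxes, whose preimages are products of two
  boxes. All transfers of null sets and of integrability to slices rest on this.\<close>

lemma distr_replace:
  assumes E: "finite E" and \<alpha>: "\<alpha> \<subseteq> E"
  shows "distr (cube E \<Otimes>\<^sub>M cube \<alpha>) (cube E) (merge (E - \<alpha>) \<alpha>) = cube E"
proof -
  let ?M = "restrict_space lborel {0..<1::real}"
  interpret product_sigma_finite "\<lambda>_::nat. ?M" by (rule product_sigma_finite_unit_interval)
  have fin: "finite \<alpha>" using \<alpha> E by (rule finite_subset)
  interpret \<alpha>: finite_measure "cube \<alpha>" using fin by (rule finite_measure_cube)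
  have "distr (cube E \<Otimes>\<^sub>M cube \<alpha>) (cube E) (merge (E - \<alpha>) \<alpha>) = (\<Pi>\<^sub>M n\<in>E. ?M)"
  proof (rule PiM_eqI[OF E])
    fix A :: "nat \<Rightarrow> real set" assume A: "\<And>i. i \<in> E \<Longrightarrow> A i \<in> sets ?M"
    \<comment> \<open>The old coordinates in \<alpha> are discarded by \<open>merge\<close>, so the
      preimage leaves them free.\<close>
    let ?A = "\<lambda>n. if n \<in> \<alpha> then {0..<1} else A n"
    have A01: "A i \<subseteq> {0..<1}" if "i \<in> E" for i
      using sets.sets_into_space[OF A[OF that]] by (simp add: space_unit_interval)
    have top: "{0..<1} \<in> sets ?M"
      using sets.top[of ?M] by (simp add: space_unit_interval)
    have s: "Pi\<^sub>E E ?A \<in> sets (cube E)" "Pi\<^sub>E \<alpha> A \<in> sets (cube \<alpha>)" "Pi\<^sub>E E A \<in> sets (cube E)"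
      unfolding cube_def using A E \<alpha> fin top by (auto intro!: sets_PiM_I_finite)
    have "merge (E - \<alpha>) \<alpha> -` Pi\<^sub>E E A \<inter> space (cube E \<Otimes>\<^sub>M cube \<alpha>) = Pi\<^sub>E E ?A \<times> Pi\<^sub>E \<alpha> A"
    proof (intro subset_antisym subsetI)
      fix z assume z: "z \<in> merge (E - \<alpha>) \<alpha> -` Pi\<^sub>E E A \<inter> space (cube E \<Otimes>\<^sub>M cube \<alpha>)"
      obtain k x where [simp]: "z = (k, x)" by (cases z)
      have m: "merge (E - \<alpha>) \<alpha> (k, x) n \<in> A n" if "n \<in> E" for n
        using z that by (auto simp: PiE_def)
      have "k n \<in> ?A n" if "n \<in> E" for n
        using m[OF that] that z by (auto simp: space_pair_measure space_cube merge_def split: if_splits)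
      moreover have "x n \<in> A n" if "n \<in> \<alpha>" for n
        using m[of n] that \<alpha> by (auto simp: merge_def split: if_splits)
      ultimately show "z \<in> Pi\<^sub>E E ?A \<times> Pi\<^sub>E \<alpha> A"
        using z by (auto simp: space_pair_measure space_cube PiE_iff)
    next
      fix z assume z: "z \<in> Pi\<^sub>E E ?A \<times> Pi\<^sub>E \<alpha> A"
      obtain k x where [simp]: "z = (k, x)" by (cases z)
      have k: "k n \<in> ?A n" if "n \<in> E" for n using z that by (auto simp: PiE_iff)
      have x: "x n \<in> A n" if "n \<in> \<alpha>" for n using z that by (auto simp: PiE_iff)
      have "merge (E - \<alpha>) \<alpha> (k, x) n \<in> A n" if "n \<in> E" for n
        using k[OF that] x that \<alpha> by (auto simp: merge_def)
      moreover have "k n \<in> {0..<1}" if "n \<in> E" for n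
        using k[OF that] A01[OF that] by (auto split: if_splits)
      moreover have "x n \<in> {0..<1}" if "n \<in> \<alpha>" for n
        using x[OF that] A01[of n] \<alpha> that by blast
      ultimately show "z \<in> merge (E - \<alpha>) \<alpha> -` Pi\<^sub>E E A \<inter> space (cube E \<Otimes>\<^sub>M cube \<alpha>)"
        using z \<alpha> by (auto simp: space_pair_measure space_cube PiE_iff extensional_def merge_def)
    qed
    then have "emeasure (distr (cube E \<Otimes>\<^sub>M cube \<alpha>) (cube E) (merge (E - \<alpha>) \<alpha>)) (Pi\<^sub>E E A) =
        emeasure (cube E) (Pi\<^sub>E E ?A) * emeasure (cube \<alpha>) (Pi\<^sub>E \<alpha> A)"
      using s by (subst emeasure_distr[OF measurable_replace[OF \<alpha>]])
        (simp_all add: \<alpha>.emeasure_pair_measure_Times)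
    also have "emeasure (cube E) (Pi\<^sub>E E ?A) = (\<Prod>n\<in>E. emeasure ?M (?A n))"
      unfolding cube_def using A E top by (intro emeasure_PiM) auto
    also have "\<dots> = (\<Prod>n\<in>E - \<alpha>. emeasure ?M (A n))"
      using E by (simp add: prod.If_cases if_distrib emeasure_unit_interval Int_commute Diff_eq cong: if_cong)
    also have "emeasure (cube \<alpha>) (Pi\<^sub>E \<alpha> A) = (\<Prod>n\<in>\<alpha>. emeasure ?M (A n))"
      unfolding cube_def using A fin \<alpha> by (intro emeasure_PiM) auto
    also have "(\<Prod>n\<in>E - \<alpha>. emeasure ?M (A n)) * (\<Prod>n\<in>\<alpha>. emeasure ?M (A n)) = (\<Prod>n\<in>E. emeasure ?M (A n))"
      using prod.subset_diff[OF \<alpha> E] by metis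
    finally show "emeasure (distr (cube E \<Otimes>\<^sub>M cube \<alpha>) (cube E) (merge (E - \<alpha>) \<alpha>)) (Pi\<^sub>E E A) =
        (\<Prod>n\<in>E. emeasure ?M (A n))" .
  qed (simp add: cube_def)
  then show ?thesis by (simp add: cube_def)
qed

text \<open>The exceptional set pulls back to a null set of the product, and almost all slices of a
  null set are null. A change of u on a null set is therefore invisible to its averages at almost
  every point, which lets the operators act on classes.\<close>

lemma AE_replace:
  assumes "finite E" "\<alpha> \<subseteq> E" "AE k in cube E. P k"
  shows "AE k in cube E. AE x in cube \<alpha>. P (merge (E - \<alpha>) \<alpha> (k, x))"
proof -
  have fin: "finite \<alpha>" using assms(2,1) by (rule finite_subset)
  interpret pair_sigma_finite "cube E" "cube \<alpha>" using assms(1) fin by (rule pair_sigma_finite_cube)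
  have "AE z in cube E \<Otimes>\<^sub>M cube \<alpha>. P (merge (E - \<alpha>) \<alpha> z)"
    using AE_distrD[OF measurable_replace[OF assms(2)]] assms(3) distr_replace[OF assms(1,2)] by metis
  then show ?thesis
    by (rule AE_pair)
qed

lemma integrable_replace:
  fixes f :: "(nat \<Rightarrow> real) \<Rightarrow> 'b :: {banach, second_countable_topology}"
  assumes "finite E" "\<alpha> \<subseteq> E" "integrable (cube E) f"
  shows "integrable (cube E \<Otimes>\<^sub>M cube \<alpha>) (\<lambda>z. f (merge (E - \<alpha>) \<alpha> z))"
  using assms distr_replace[OF assms(1,2)] integrable_distr[OF measurable_replace[OF assms(2)], of f]
  by simp

lemma AE_integrable_replace:
  fixes f :: "(nat \<Rightarrow> real) \<Rightarrow> 'b :: {banach, second_countable_topology}"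
  assumes "finite E" "\<alpha> \<subseteq> E" "integrable (cube E) f"
  shows "AE k in cube E. integrable (cube \<alpha>) (\<lambda>x. f (merge (E - \<alpha>) \<alpha> (k, x)))"
proof -
  interpret pair_sigma_finite "cube E" "cube \<alpha>"
    using assms by (intro pair_sigma_finite_cube) (auto intro: finite_subset)
  show ?thesis by (rule AE_integrable_fst'[OF integrable_replace[OF assms]])
qed

declare One_nat_def [simp del]

section \<open>Cells and cell averages\<close>

text \<open>Cells are numbered from 1, hence the summand 1. Recording the cell of a point as a
  multi-index lets sums over i against products of \<open>step\<close> collapse to evaluation at
  \<open>cell_index\<close>.\<close>

definition cell_index :: "nat \<Rightarrow> nat \<Rightarrow> (nat \<Rightarrow> real) \<Rightarrow> nat \<Rightarrow> nat" where
  "cell_index p N k = (\<lambda>n\<in>{1..N}. nat \<lfloor>real p * k n\<rfloor> + 1)"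

text \<open>For m in \<open>multi_indices p \<alpha>\<close> this is the density of the uniform
  distribution on the cell m of the \<alpha> coordinates.\<close>

definition cell_weight :: "nat \<Rightarrow> nat set \<Rightarrow> (nat \<Rightarrow> nat) \<Rightarrow> (nat \<Rightarrow> real) \<Rightarrow> complex" where
  "cell_weight p \<alpha> m x = of_nat p ^ card \<alpha> * (\<Prod>n\<in>\<alpha>. step p (m n) (x n))"

definition cell_average :: "nat \<Rightarrow> nat \<Rightarrow> nat set \<Rightarrow> (nat \<Rightarrow> nat) \<Rightarrow>
    ((nat \<Rightarrow> real) \<Rightarrow> complex) \<Rightarrow> (nat \<Rightarrow> real) \<Rightarrow> complex" where
  "cell_average p N \<alpha> m u k =
     (\<integral>x. cell_weight p \<alpha> m x * u (merge ({1..N} - \<alpha>) \<alpha> (k, x)) \<partial>cube \<alpha>)"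

text \<open>The Haar function, repeated on every cell without normalisation. Its modulus 1 matters
  besides its mean zero: products of its values never vanish and can be cancelled pointwise.\<close>

definition half_sign :: "nat \<Rightarrow> real \<Rightarrow> complex" where
  "half_sign p x = (if frac (real p * x) < 1 / 2 then 1 else - 1)"

lemma step_eq_of_bool:
  assumes "p \<ge> 1" "r \<ge> 1" "0 \<le> x"
  shows "step p r x = of_bool (r = nat \<lfloor>real p * x\<rfloor> + 1)"
proof -
  have "r = nat \<lfloor>real p * x\<rfloor> + 1 \<longleftrightarrow> \<lfloor>real p * x\<rfloor> = int r - 1"
    using assms by auto
  also have "\<dots> \<longleftrightarrow> real r - 1 \<le> real p * x \<and> real p * x < real r"
    by (simp add: floor_eq_iff)
  also have "\<dots> \<longleftrightarrow> x \<in> {(real r - 1) / real p ..< real r / real p}"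
    using assms by (simp add: field_simps)
  finally show ?thesis
    by (simp add: step_def indicator_def of_bool_def)
qed

lemma borel_measurable_step [measurable]: "step p r \<in> borel_measurable borel"
  unfolding step_def by measurable

lemma borel_measurable_half_sign [measurable]: "half_sign p \<in> borel_measurable borel"
  unfolding half_sign_def frac_def by measurable

lemma norm_half_sign [simp]: "norm (half_sign p x) = 1"
  by (simp add: half_sign_def)

lemma cell_index_mem:
  assumes "p \<ge> 1" "k \<in> space (cube {1..N})"
  shows "cell_index p N k \<in> multi_indices p {1..N}"
proof -
  have "nat \<lfloor>real p * k n\<rfloor> + 1 \<in> {1..p}" if n: "n \<in> {1..N}" for n
  proof -
    \<comment> \<open>Half-openness of the cube enters here: \<open>k n = 1\<close> would give the
      index p + 1.\<close>
    have k: "0 \<le> k n" "k n < 1" using assms n by (auto simp: space_cube PiE_iff)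
    then have "real p * k n < real p" using assms by simp
    then have "\<lfloor>real p * k n\<rfloor> < int p" by (simp add: floor_less_iff)
    then show ?thesis using assms by auto
  qed
  then show ?thesis
    unfolding cell_index_def multi_indices_def by (auto simp del: atLeastAtMost_iff)
qed

lemma prod_step_eq_of_bool:
  assumes "p \<ge> 1" "finite \<alpha>" "m \<in> multi_indices p \<alpha>" "x \<in> space (cube \<alpha>)"
  shows "(\<Prod>n\<in>\<alpha>. step p (m n) (x n)) = of_bool (\<forall>n\<in>\<alpha>. m n = nat \<lfloor>real p * x n\<rfloor> + 1)"
proof -
  have "step p (m n) (x n) = of_bool (m n = nat \<lfloor>real p * x n\<rfloor> + 1)" if "n \<in> \<alpha>" for n
    using assms that by (intro step_eq_of_bool) (auto simp: multi_indices_def space_cube PiE_iff)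
  then have "(\<Prod>n\<in>\<alpha>. step p (m n) (x n)) = (\<Prod>n\<in>\<alpha>. of_bool (m n = nat \<lfloor>real p * x n\<rfloor> + 1))"
    by (rule prod.cong[OF refl])
  also have "\<dots> = of_bool (\<forall>n\<in>\<alpha>. m n = nat \<lfloor>real p * x n\<rfloor> + 1)"
    using assms(2) by (induction \<alpha>) auto
  finally show ?thesis .
qed

lemma prod_step_cell_index:
  assumes "p \<ge> 1" "i \<in> multi_indices p {1..N}" "k \<in> space (cube {1..N})"
  shows "(\<Prod>n\<in>{1..N}. step p (i n) (k n)) = of_bool (cell_index p N k = i)"
proof -
  have "(\<forall>n\<in>{1..N}. i n = nat \<lfloor>real p * k n\<rfloor> + 1) \<longleftrightarrow> cell_index p N k = i"
    using assms by (auto simp: cell_index_def multi_indices_def fun_eq_iff PiE_iff extensional_def)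
  then show ?thesis using assms by (subst prod_step_eq_of_bool) auto
qed

lemma cell_weight_eq:
  assumes "p \<ge> 1" "finite \<alpha>" "m \<in> multi_indices p \<alpha>" "x \<in> space (cube \<alpha>)"
  shows "cell_weight p \<alpha> m x = of_nat p ^ card \<alpha> * of_bool (\<forall>n\<in>\<alpha>. m n = nat \<lfloor>real p * x n\<rfloor> + 1)"
  using assms by (simp add: cell_weight_def prod_step_eq_of_bool)

lemma borel_measurable_cell_weight [measurable]:
  "cell_weight p \<alpha> m \<in> borel_measurable (cube \<alpha>)"
proof -
  note measurable_component_cube [measurable]
  show ?thesis unfolding cell_weight_def by measurable
qed

lemma norm_cell_weight_le:
  "norm (cell_weight p \<alpha> m x) \<le> real p ^ card \<alpha>"
proof -
  have "norm (\<Prod>n\<in>\<alpha>. step p (m n) (x n)) \<le> 1"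
    unfolding prod_norm[symmetric] by (intro prod_le_1) (simp add: step_def indicator_def)
  then show ?thesis
    by (simp add: cell_weight_def norm_mult norm_power mult_left_le)
qed

lemma integrable_cell_weight_mult:
  assumes "integrable (cube \<alpha>) f"
  shows "integrable (cube \<alpha>) (\<lambda>x. cell_weight p \<alpha> m x * f x)"
proof (rule Bochner_Integration.integrable_bound)
  show "integrable (cube \<alpha>) (\<lambda>x. real p ^ card \<alpha> * norm (f x))"
    using assms by simp
  show "(\<lambda>x. cell_weight p \<alpha> m x * f x) \<in> borel_measurable (cube \<alpha>)"
    using assms by simp
  show "AE x in cube \<alpha>. norm (cell_weight p \<alpha> m x * f x) \<le> norm (real p ^ card \<alpha> * norm (f x))"
    by (simp add: norm_mult abs_mult mult_right_mono norm_cell_weight_le)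
qed

lemma cell_index_merge:
  assumes "p \<ge> 1" "\<alpha> \<subseteq> {1..N}" "m \<in> multi_indices p \<alpha>" "x \<in> space (cube \<alpha>)"
    and "cell_weight p \<alpha> m x \<noteq> 0"
  shows "cell_index p N (merge ({1..N} - \<alpha>) \<alpha> (k, x)) = merge ({1..N} - \<alpha>) \<alpha> (cell_index p N k, m)"
proof -
  have "finite \<alpha>" using assms(2) by (rule finite_subset) simp
  then have "m n = nat \<lfloor>real p * x n\<rfloor> + 1" if "n \<in> \<alpha>" for n
    using assms that by (subst (asm) cell_weight_eq) auto
  then show ?thesis
    using assms(2) by (auto simp: cell_index_def merge_def fun_eq_iff)
qed

text \<open>
  The weight vanishes unless the resampled coordinates lie in the cell \<open>m\<close>, so a factor depending
  only on the cell comes out of the integral at every point, not just almost everywhere.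
\<close>

lemma cell_average_mult:
  assumes "p \<ge> 1" "\<alpha> \<subseteq> {1..N}" "m \<in> multi_indices p \<alpha>"
  shows "cell_average p N \<alpha> m (\<lambda>k. g (cell_index p N k) * w k) k =
    g (merge ({1..N} - \<alpha>) \<alpha> (cell_index p N k, m)) * cell_average p N \<alpha> m w k"
proof -
  have "cell_weight p \<alpha> m x * (g (cell_index p N (merge ({1..N} - \<alpha>) \<alpha> (k, x))) * w (merge ({1..N} - \<alpha>) \<alpha> (k, x))) =
    g (merge ({1..N} - \<alpha>) \<alpha> (cell_index p N k, m)) * (cell_weight p \<alpha> m x * w (merge ({1..N} - \<alpha>) \<alpha> (k, x)))"
    if "x \<in> space (cube \<alpha>)" for x
    using cell_index_merge[OF assms that] by (cases "cell_weight p \<alpha> m x = 0") auto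
  then show ?thesis
    unfolding cell_average_def integral_mult_right_zero[symmetric]
    by (intro Bochner_Integration.integral_cong) auto
qed

section \<open>Integrals over a single cell in one dimension\<close>

lemma integral_unit_interval:
  fixes f :: "real \<Rightarrow> complex"
  shows "(\<integral>x. f x \<partial>restrict_space lborel {0..<1}) = (\<integral>x. indicator {0..<1} x *\<^sub>R f x \<partial>lborel)"
  by (subst integral_restrict_space) auto

lemma integrable_unit_interval_bounded:
  fixes f :: "real \<Rightarrow> complex"
  assumes "f \<in> borel_measurable borel" "\<And>x. norm (f x) \<le> C"
  shows "integrable (restrict_space lborel {0..<1}) f"
proof -
  interpret finite_measure "restrict_space lborel {0..<1::real}" by (rule finite_measure_unit_interval)
  show ?thesis
    using assms by (intro integrable_const_bound[where B = C]) (auto intro: measurable_restrict_space1)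
qed

lemma cell_subset:
  assumes "p \<ge> 1" "r \<in> {1..p}"
  shows "{(real r - 1) / real p ..< real r / real p} \<subseteq> {0..<1}"
proof
  fix x assume "x \<in> {(real r - 1) / real p ..< real r / real p}"
  moreover have "0 \<le> (real r - 1) / real p" "real r / real p \<le> 1" using assms by auto
  ultimately show "x \<in> {0..<1}" by auto
qed

lemma has_bochner_integral_Ico:
  fixes a b :: real
  assumes "a \<le> b"
  shows "has_bochner_integral lborel (\<lambda>x. indicator {a..<b} x *\<^sub>R (1::complex)) (of_real (b - a))"
  using has_bochner_integral_indicator[of "{a..<b}" lborel "1::complex"] assms
  by (simp add: of_real_def)

lemma integral_step:
  assumes "p \<ge> 1" "r \<in> {1..p}"
  shows "(\<integral>x. step p r x \<partial>restrict_space lborel {0..<1}) = 1 / of_nat p"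
proof -
  have "indicator {0..<1} x *\<^sub>R step p r x = indicator {(real r - 1) / real p ..< real r / real p} x *\<^sub>R (1::complex)" for x
    using cell_subset[OF assms] by (auto simp: step_def indicator_def)
  then have "(\<integral>x. step p r x \<partial>restrict_space lborel {0..<1}) =
      of_real (real r / real p - (real r - 1) / real p)"
    unfolding integral_unit_interval
    using assms by (simp only:) (intro has_bochner_integral_integral_eq has_bochner_integral_Ico, simp add: field_simps)
  also have "real r / real p - (real r - 1) / real p = 1 / real p"
    using assms by (simp add: field_simps)
  finally show ?thesis by simp
qed

lemma integral_step_half_sign:
  assumes "p \<ge> 1" "r \<in> {1..p}"
  shows "(\<integral>x. step p r x * half_sign p x \<partial>restrict_space lborel {0..<1}) = 0"
proof -
  \<comment> \<open>\<open>?b\<close> is the midpoint of the cell, where \<open>half_sign\<close>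
    changes from 1 to -1.\<close>
  let ?a = "(real r - 1) / real p" and ?b = "(real r - 1 / 2) / real p" and ?c = "real r / real p"
  have "indicator {0..<1} x *\<^sub>R (step p r x * half_sign p x) =
      indicator {?a ..< ?b} x *\<^sub>R (1::complex) - indicator {?b ..< ?c} x *\<^sub>R 1" for x
  proof (cases "x \<in> {?a ..< ?c}")
    case True
    then have x: "real r - 1 \<le> real p * x" "real p * x < real r"
      using assms by (auto simp: field_simps)
    then have "\<lfloor>real p * x\<rfloor> = int r - 1"
      by (simp add: floor_eq_iff)
    then have fr: "frac (real p * x) < 1 / 2 \<longleftrightarrow> x < ?b"
      using assms by (auto simp: frac_def field_simps)
    have "x \<in> {0..<1}" using True cell_subset[OF assms] by blast
    moreover have "step p r x = 1" using True by (simp add: step_def)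
    ultimately show ?thesis using True fr by (auto simp: half_sign_def indicator_def)
  next
    case False
    moreover have "?a \<le> ?b" "?b \<le> ?c" using assms by (auto simp: field_simps)
    ultimately show ?thesis by (auto simp: step_def indicator_def)
  qed
  then have "(\<integral>x. step p r x * half_sign p x \<partial>restrict_space lborel {0..<1}) =
      (\<integral>x. indicator {?a ..< ?b} x *\<^sub>R (1::complex) - indicator {?b ..< ?c} x *\<^sub>R 1 \<partial>lborel)"
    unfolding integral_unit_interval by simp
  also have "\<dots> = of_real (?b - ?a) - of_real (?c - ?b)"
    using assms
    by (intro has_bochner_integral_integral_eq has_bochner_integral_diff has_bochner_integral_Ico)
      (simp_all add: field_simps)
  also have "?b - ?a = ?c - ?b"
    using assms by (simp add: field_simps)
  finally show ?thesis by simp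
qed

text \<open>The integrand splits into one factor per coordinate. A coordinate in \<alpha>
  contributes 1 if it lies in \<gamma>, where no sign is present, and 0 otherwise, by the mean zero
  of the sign on a cell; coordinates outside \<alpha> keep their sign.\<close>

lemma cell_average_half_sign:
  assumes "p \<ge> 1" "\<alpha> \<subseteq> {1..N}" "m \<in> multi_indices p \<alpha>"
  shows "cell_average p N \<alpha> m (\<lambda>k. \<Prod>n\<in>{1..N} - \<gamma>. half_sign p (k n)) k =
     of_bool (\<alpha> \<subseteq> \<gamma>) * (\<Prod>n\<in>{1..N} - \<gamma>. half_sign p (k n))"
proof -
  have fin: "finite \<alpha>" using assms(2) by (rule finite_subset) simp
  interpret product_sigma_finite "\<lambda>_::nat. restrict_space lborel {0..<1::real}"
    by (rule product_sigma_finite_unit_interval)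
  let ?f = "\<lambda>n x. of_nat p * (step p (m n) x * (if n \<in> \<gamma> then 1 else half_sign p x))"
  let ?H = "\<Prod>n\<in>{1..N} - \<gamma> - \<alpha>. half_sign p (k n)"
  have "cell_weight p \<alpha> m x * (\<Prod>n\<in>{1..N} - \<gamma>. half_sign p (merge ({1..N} - \<alpha>) \<alpha> (k, x) n)) =
      ?H * (\<Prod>n\<in>\<alpha>. ?f n (x n))" for x
  proof -
    \<comment> \<open>Only the signs at coordinates in \<alpha> - \<gamma> are affected by the
      resampling; the others come out of the integral.\<close>
    have "(\<Prod>n\<in>{1..N} - \<gamma>. half_sign p (merge ({1..N} - \<alpha>) \<alpha> (k, x) n)) =
       (\<Prod>n\<in>{1..N} - \<gamma> - (\<alpha> - \<gamma>). half_sign p (merge ({1..N} - \<alpha>) \<alpha> (k, x) n)) *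
       (\<Prod>n\<in>\<alpha> - \<gamma>. half_sign p (merge ({1..N} - \<alpha>) \<alpha> (k, x) n))"
      using assms by (intro prod.subset_diff) auto
    also have "{1..N} - \<gamma> - (\<alpha> - \<gamma>) = {1..N} - \<gamma> - \<alpha>" by auto
    also have "(\<Prod>n\<in>{1..N} - \<gamma> - \<alpha>. half_sign p (merge ({1..N} - \<alpha>) \<alpha> (k, x) n)) = ?H"
      by (intro prod.cong) (auto simp: merge_def)
    also have "(\<Prod>n\<in>\<alpha> - \<gamma>. half_sign p (merge ({1..N} - \<alpha>) \<alpha> (k, x) n)) =
        (\<Prod>n\<in>\<alpha>. if n \<in> \<gamma> then 1 else half_sign p (x n))"
      using fin by (intro prod.mono_neutral_cong_left) (auto simp: merge_def)
    finally show ?thesis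
      by (simp add: cell_weight_def prod.distrib)
  qed
  then have "cell_average p N \<alpha> m (\<lambda>k. \<Prod>n\<in>{1..N} - \<gamma>. half_sign p (k n)) k =
      ?H * (\<integral>x. (\<Prod>n\<in>\<alpha>. ?f n (x n)) \<partial>cube \<alpha>)"
    by (simp add: cell_average_def)
  also have "(\<integral>x. (\<Prod>n\<in>\<alpha>. ?f n (x n)) \<partial>cube \<alpha>) =
      (\<Prod>n\<in>\<alpha>. \<integral>x. ?f n x \<partial>restrict_space lborel {0..<1})"
    unfolding cube_def
  proof (rule product_integral_prod[OF fin])
    fix n
    show "integrable (restrict_space lborel {0..<1}) (?f n)"
      by (rule integrable_unit_interval_bounded[where C = "real p"])
        (auto simp: norm_mult step_def indicator_def)
  qed
  also have "\<dots> = (\<Prod>n\<in>\<alpha>. of_bool (n \<in> \<gamma>))"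
  proof (rule prod.cong[OF refl])
    fix n assume "n \<in> \<alpha>"
    then have "m n \<in> {1..p}" using assms(3) by (auto simp: multi_indices_def PiE_iff)
    then show "(\<integral>x. ?f n x \<partial>restrict_space lborel {0..<1}) = of_bool (n \<in> \<gamma>)"
      using assms integral_step[of p "m n"] integral_step_half_sign[of p "m n"] by simp
  qed
  also have "\<dots> = of_bool (\<alpha> \<subseteq> \<gamma>)"
    using fin by (induction \<alpha>) auto
  \<comment> \<open>If \<alpha> \<subseteq> \<gamma>, removing \<alpha> from the complement of
    \<gamma> removes nothing; otherwise both sides are 0.\<close>
  also have "?H * of_bool (\<alpha> \<subseteq> \<gamma>) = of_bool (\<alpha> \<subseteq> \<gamma>) * (\<Prod>n\<in>{1..N} - \<gamma>. half_sign p (k n))"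
    by (cases "\<alpha> \<subseteq> \<gamma>") (auto intro!: prod.cong)
  finally show ?thesis .
qed

text \<open>Taking \<open>{1..N}\<close> for \<gamma> empties the product of signs, and what remains
  is the average of the constant 1.\<close>

lemma integral_cell_weight:
  assumes "p \<ge> 1" "\<alpha> \<subseteq> {1..N}" "m \<in> multi_indices p \<alpha>"
  shows "(\<integral>x. cell_weight p \<alpha> m x \<partial>cube \<alpha>) = 1"
  using cell_average_half_sign[OF assms, of "{1..N}"] assms(2) by (simp add: cell_average_def)

section \<open>Square-integrable functions and their averages\<close>

lemma square_integrable_measurable: "u \<in> square_integrable N \<Longrightarrow> u \<in> borel_measurable (cube {1..N})"
  by (simp add: square_integrable_def)

text \<open>The measure is finite and t \<le> 1 + t^2. Fubini's theorem asks for integrability of u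
  itself, and this is how square integrability reaches the slices.\<close>

lemma square_integrable_integrable:
  assumes "u \<in> square_integrable N"
  shows "integrable (cube {1..N}) u"
proof -
  interpret finite_measure "cube {1..N}" by (rule finite_measure_cube) simp
  have "cmod (u k) \<le> 1 + (cmod (u k))\<^sup>2" for k
  proof -
    have "0 \<le> (cmod (u k) - 1)\<^sup>2 + cmod (u k)" by simp
    then show ?thesis by (simp add: power2_diff)
  qed
  then have "AE k in cube {1..N}. norm (u k) \<le> norm (1 + (cmod (u k))\<^sup>2)"
    by simp
  moreover have "integrable (cube {1..N}) (\<lambda>k. 1 + (cmod (u k))\<^sup>2)"
    using assms by (simp add: square_integrable_def)
  ultimately show ?thesis
    using square_integrable_measurable[OF assms] Bochner_Integration.integrable_bound by blast
qed

lemma square_integrable_bound: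
  assumes "u \<in> borel_measurable (cube {1..N})" "integrable (cube {1..N}) f"
    and "AE k in cube {1..N}. (cmod (u k))\<^sup>2 \<le> f k"
  shows "u \<in> square_integrable N"
proof -
  have "integrable (cube {1..N}) (\<lambda>k. (cmod (u k))\<^sup>2)"
    using assms by (intro Bochner_Integration.integrable_bound[OF assms(2)]) auto
  then show ?thesis using assms by (simp add: square_integrable_def)
qed

lemma square_integrable_bounded:
  assumes "u \<in> borel_measurable (cube {1..N})" "\<And>k. k \<in> space (cube {1..N}) \<Longrightarrow> cmod (u k) \<le> C"
  shows "u \<in> square_integrable N"
proof (rule square_integrable_bound)
  interpret finite_measure "cube {1..N}" by (rule finite_measure_cube) simp
  show "integrable (cube {1..N}) (\<lambda>k. C\<^sup>2)" by simp
  show "AE k in cube {1..N}. (cmod (u k))\<^sup>2 \<le> C\<^sup>2"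
    using assms by (intro AE_I2 power_mono) auto
qed (use assms in simp)

lemma square_integrable_add:
  assumes "u \<in> square_integrable N" "v \<in> square_integrable N"
  shows "(\<lambda>k. u k + v k) \<in> square_integrable N"
proof (rule square_integrable_bound)
  show "integrable (cube {1..N}) (\<lambda>k. 2 * (cmod (u k))\<^sup>2 + 2 * (cmod (v k))\<^sup>2)"
    using assms by (simp add: square_integrable_def)
  have "(cmod (u k + v k))\<^sup>2 \<le> 2 * (cmod (u k))\<^sup>2 + 2 * (cmod (v k))\<^sup>2" for k
  proof -
    have "(cmod (u k + v k))\<^sup>2 \<le> (cmod (u k) + cmod (v k))\<^sup>2"
      by (intro power_mono norm_triangle_ineq) auto
    also have "\<dots> \<le> 2 * (cmod (u k))\<^sup>2 + 2 * (cmod (v k))\<^sup>2"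
      using sum_power2_ge_zero[of "cmod (u k) - cmod (v k)" 0] by (simp add: power2_sum power2_diff)
    finally show ?thesis .
  qed
  then show "AE k in cube {1..N}. (cmod (u k + v k))\<^sup>2 \<le> 2 * (cmod (u k))\<^sup>2 + 2 * (cmod (v k))\<^sup>2"
    by simp
qed (use assms in \<open>auto simp: square_integrable_def\<close>)

lemma square_integrable_mult:
  assumes "u \<in> square_integrable N" "g \<in> borel_measurable (cube {1..N})"
    and "\<And>k. k \<in> space (cube {1..N}) \<Longrightarrow> cmod (g k) \<le> C"
  shows "(\<lambda>k. g k * u k) \<in> square_integrable N"
proof (rule square_integrable_bound)
  show "integrable (cube {1..N}) (\<lambda>k. C\<^sup>2 * (cmod (u k))\<^sup>2)"
    using assms by (simp add: square_integrable_def)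
  show "AE k in cube {1..N}. (cmod (g k * u k))\<^sup>2 \<le> C\<^sup>2 * (cmod (u k))\<^sup>2"
    using assms by (intro AE_I2) (auto simp: norm_mult power_mult_distrib intro!: mult_right_mono power_mono)
qed (use assms in \<open>auto simp: square_integrable_def\<close>)

lemma square_integrable_const_mult:
  assumes "u \<in> square_integrable N"
  shows "(\<lambda>k. c * u k) \<in> square_integrable N"
  using assms by (rule square_integrable_mult[where C = "cmod c"]) auto

lemma square_integrable_zero: "(\<lambda>k. 0) \<in> square_integrable N"
  by (rule square_integrable_bounded[where C = 0]) auto

lemma square_integrable_sum:
  assumes "\<And>s. s \<in> S \<Longrightarrow> f s \<in> square_integrable N"
  shows "(\<lambda>k. \<Sum>s\<in>S. f s k) \<in> square_integrable N"
  using assms by (induction S rule: infinite_finite_induct)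
    (auto intro: square_integrable_add square_integrable_zero)

lemma square_integrable_cong_AE:
  assumes "u \<in> borel_measurable (cube {1..N})" "v \<in> square_integrable N" "AE k in cube {1..N}. u k = v k"
  shows "u \<in> square_integrable N"
proof (rule square_integrable_bound)
  show "integrable (cube {1..N}) (\<lambda>k. (cmod (v k))\<^sup>2)"
    using assms by (simp add: square_integrable_def)
  show "AE k in cube {1..N}. (cmod (u k))\<^sup>2 \<le> (cmod (v k))\<^sup>2"
    using assms(3) by eventually_elim simp
qed (rule assms)

text \<open>There are finitely many cells, so for any g the composite is a finite linear combination
  of products of \<open>step\<close> functions.\<close>

lemma borel_measurable_cell_index:
  assumes "p \<ge> 1"
  shows "(\<lambda>k. g (cell_index p N k) :: complex) \<in> borel_measurable (cube {1..N})"
proof -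
  note measurable_component_cube [measurable]
  have "(\<lambda>k. \<Sum>i\<in>multi_indices p {1..N}. g i * (\<Prod>n\<in>{1..N}. step p (i n) (k n))) \<in> borel_measurable (cube {1..N})"
    by measurable
  also have "?this \<longleftrightarrow> ?thesis"
  proof (rule measurable_cong)
    fix k assume k: "k \<in> space (cube {1..N})"
    have "(\<Sum>i\<in>multi_indices p {1..N}. g i * (\<Prod>n\<in>{1..N}. step p (i n) (k n))) =
        (\<Sum>i\<in>multi_indices p {1..N}. if i = cell_index p N k then g i else 0)"
      using assms k by (intro sum.cong) (auto simp: prod_step_cell_index)
    also have "\<dots> = g (cell_index p N k)"
      using cell_index_mem[OF assms k] by (simp add: multi_indices_def finite_PiE)
    finally show "(\<Sum>i\<in>multi_indices p {1..N}. g i * (\<Prod>n\<in>{1..N}. step p (i n) (k n))) = g (cell_index p N k)" .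
  qed
  finally show ?thesis .
qed

lemma square_integrable_cell_index_mult:
  assumes "p \<ge> 1" "u \<in> square_integrable N"
  shows "(\<lambda>k. g (cell_index p N k) * u k) \<in> square_integrable N"
proof (rule square_integrable_mult[OF assms(2) borel_measurable_cell_index[OF assms(1)]])
  fix k assume "k \<in> space (cube {1..N})"
  then show "cmod (g (cell_index p N k)) \<le> (\<Sum>i\<in>multi_indices p {1..N}. cmod (g i))"
    using cell_index_mem[OF assms(1)]
    by (intro member_le_sum) (auto simp: multi_indices_def intro: finite_PiE)
qed

text \<open>Jensen's inequality for the square, read off from the nonnegative variance of
  \<open>cmod (f x)\<close>.\<close>

lemma (in finite_measure) power2_norm_integral_le:
  fixes f :: "'a \<Rightarrow> complex"
  assumes "measure M (space M) = 1" "integrable M f" "integrable M (\<lambda>x. (cmod (f x))\<^sup>2)"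
  shows "(cmod (\<integral>x. f x \<partial>M))\<^sup>2 \<le> (\<integral>x. (cmod (f x))\<^sup>2 \<partial>M)"
proof -
  let ?c = "\<integral>x. cmod (f x) \<partial>M"
  have "0 \<le> (\<integral>x. (cmod (f x) - ?c)\<^sup>2 \<partial>M)" by simp
  also have "\<dots> = (\<integral>x. (cmod (f x))\<^sup>2 - 2 * ?c * cmod (f x) + ?c\<^sup>2 \<partial>M)"
    by (simp add: power2_diff algebra_simps)
  also have "\<dots> = (\<integral>x. (cmod (f x))\<^sup>2 \<partial>M) - 2 * ?c * ?c + ?c\<^sup>2"
    using assms by simp
  also have "\<dots> = (\<integral>x. (cmod (f x))\<^sup>2 \<partial>M) - ?c\<^sup>2"
    by (simp add: power2_eq_square)
  finally have "?c\<^sup>2 \<le> (\<integral>x. (cmod (f x))\<^sup>2 \<partial>M)" by simp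
  moreover have "(cmod (\<integral>x. f x \<partial>M))\<^sup>2 \<le> ?c\<^sup>2"
    by (intro power_mono integral_norm_bound) auto
  ultimately show ?thesis by linarith
qed

lemma measurable_replace_slice:
  assumes "\<alpha> \<subseteq> {1..N}" "k \<in> space (cube {1..N})" "u \<in> borel_measurable (cube {1..N})"
  shows "(\<lambda>x. u (merge ({1..N} - \<alpha>) \<alpha> (k, x))) \<in> borel_measurable (cube \<alpha>)"
  using measurable_compose[OF measurable_compose[OF measurable_Pair1'[OF assms(2)] measurable_replace[OF assms(1)]] assms(3)]
  by simp

lemma AE_integrable_slices:
  assumes "u \<in> square_integrable N"
  shows "AE k in cube {1..N}. \<forall>\<alpha>\<in>Pow {1..N}. integrable (cube \<alpha>) (\<lambda>x. u (merge ({1..N} - \<alpha>) \<alpha> (k, x)))"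
  by (rule AE_finite_allI) (auto intro!: AE_integrable_replace square_integrable_integrable assms)

text \<open>On almost every slice Jensen bounds the squared average by the mean of the square, at
  the price of \<open>?C\<^sup>2\<close> for the weight; Fubini and \<open>distr_replace\<close>
  make that bound integrable in k.\<close>

lemma square_integrable_cell_average:
  assumes "\<alpha> \<subseteq> {1..N}" "u \<in> square_integrable N"
  shows "cell_average p N \<alpha> m u \<in> square_integrable N"
proof (rule square_integrable_bound)
  have fin: "finite \<alpha>" using assms(1) by (rule finite_subset) simp
  let ?r = "\<lambda>k x. merge ({1..N} - \<alpha>) \<alpha> (k, x)"
  let ?C = "real p ^ card \<alpha>"
  interpret \<alpha>: finite_measure "cube \<alpha>" using fin by (rule finite_measure_cube)
  interpret pair_sigma_finite "cube {1..N}" "cube \<alpha>" by (rule pair_sigma_finite_cube) (simp_all add: fin)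
  have sq: "integrable (cube {1..N}) (\<lambda>k. (cmod (u k))\<^sup>2)"
    using assms(2) by (simp add: square_integrable_def)
  have um: "(\<lambda>z. u (merge ({1..N} - \<alpha>) \<alpha> z)) \<in> borel_measurable (cube {1..N} \<Otimes>\<^sub>M cube \<alpha>)"
    using measurable_compose[OF measurable_replace square_integrable_measurable] assms by blast
  have "(\<lambda>(k, x). cell_weight p \<alpha> m x * u (?r k x)) \<in> borel_measurable (cube {1..N} \<Otimes>\<^sub>M cube \<alpha>)"
    using um by (simp add: case_prod_beta)
  then show "cell_average p N \<alpha> m u \<in> borel_measurable (cube {1..N})"
    unfolding cell_average_def[abs_def] by (rule \<alpha>.borel_measurable_lebesgue_integral)
  have "integrable (cube {1..N}) (\<lambda>k. \<integral>x. (cmod (u (?r k x)))\<^sup>2 \<partial>cube \<alpha>)"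
    using integrable_fst'[OF integrable_replace[OF _ assms(1) sq]] by simp
  then show "integrable (cube {1..N}) (\<lambda>k. ?C\<^sup>2 * (\<integral>x. (cmod (u (?r k x)))\<^sup>2 \<partial>cube \<alpha>))"
    by simp
  show "AE k in cube {1..N}. (cmod (cell_average p N \<alpha> m u k))\<^sup>2 \<le> ?C\<^sup>2 * (\<integral>x. (cmod (u (?r k x)))\<^sup>2 \<partial>cube \<alpha>)"
    using AE_integrable_replace[OF finite_atLeastAtMost assms(1) sq] AE_integrable_replace[OF finite_atLeastAtMost assms(1) square_integrable_integrable[OF assms(2)]]
  proof eventually_elim
    case (elim k)
    let ?f = "\<lambda>x. cell_weight p \<alpha> m x * u (?r k x)"
    have int: "integrable (cube \<alpha>) ?f" using elim(2) by (rule integrable_cell_weight_mult)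
    have le: "(cmod (?f x))\<^sup>2 \<le> ?C\<^sup>2 * (cmod (u (?r k x)))\<^sup>2" for x
      using norm_cell_weight_le[of p \<alpha> m x]
      by (auto simp: norm_mult power_mult_distrib intro!: mult_right_mono power_mono)
    have int2: "integrable (cube \<alpha>) (\<lambda>x. (cmod (?f x))\<^sup>2)"
      by (rule Bochner_Integration.integrable_bound[of _ "\<lambda>x. ?C\<^sup>2 * (cmod (u (?r k x)))\<^sup>2"])
        (use elim int le in auto)
    have "(cmod (cell_average p N \<alpha> m u k))\<^sup>2 \<le> (\<integral>x. (cmod (?f x))\<^sup>2 \<partial>cube \<alpha>)"
      unfolding cell_average_def
      by (rule \<alpha>.power2_norm_integral_le[OF measure_space_cube[OF fin] int int2])
    also have "\<dots> \<le> (\<integral>x. ?C\<^sup>2 * (cmod (u (?r k x)))\<^sup>2 \<partial>cube \<alpha>)"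
      using elim le by (intro integral_mono int2) auto
    finally show ?case by simp
  qed
qed

lemma cell_average_cong_AE:
  assumes "\<alpha> \<subseteq> {1..N}" "u \<in> borel_measurable (cube {1..N})" "v \<in> borel_measurable (cube {1..N})"
    and "AE k in cube {1..N}. u k = v k"
  shows "AE k in cube {1..N}. cell_average p N \<alpha> m u k = cell_average p N \<alpha> m v k"
  using AE_replace[OF finite_atLeastAtMost assms(1,4)] AE_space
proof eventually_elim
  case (elim k)
  show ?case
    unfolding cell_average_def using elim
    by (intro integral_cong_AE borel_measurable_times borel_measurable_cell_weight
        measurable_replace_slice assms) auto
qed

lemma cell_average_sum_AE:
  assumes "\<alpha> \<subseteq> {1..N}" "finite S" "\<And>s. s \<in> S \<Longrightarrow> f s \<in> square_integrable N"
  shows "AE k in cube {1..N}. cell_average p N \<alpha> m (\<lambda>k. \<Sum>s\<in>S. f s k) k = (\<Sum>s\<in>S. cell_average p N \<alpha> m (f s) k)"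
proof -
  have "AE k in cube {1..N}. \<forall>s\<in>S. integrable (cube \<alpha>) (\<lambda>x. f s (merge ({1..N} - \<alpha>) \<alpha> (k, x)))"
    using assms by (intro AE_finite_allI AE_integrable_replace square_integrable_integrable) auto
  then show ?thesis
    by eventually_elim
      (simp add: cell_average_def sum_distrib_left Bochner_Integration.integral_sum integrable_cell_weight_mult)
qed

section \<open>Composition of mixed operators\<close>

definition term_indices :: "nat \<Rightarrow> nat \<Rightarrow> (nat set \<times> (nat \<Rightarrow> nat)) set" where
  "term_indices p N = (SIGMA \<alpha>:Pow {1..N}. multi_indices p \<alpha>)"

text \<open>The working form of \<open>mixed_integral\<close>: a point lies in one cell only, so the
  sum over i is already evaluated, and the integral is distributed over m. For square-integrable u
  both forms agree almost everywhere.\<close>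

definition cell_form :: "nat \<Rightarrow> nat \<Rightarrow> coefficients \<Rightarrow>
    ((nat \<Rightarrow> real) \<Rightarrow> complex) \<Rightarrow> (nat \<Rightarrow> real) \<Rightarrow> complex" where
  "cell_form p N a u k =
     (\<Sum>(\<alpha>, m)\<in>term_indices p N. a (\<alpha>, cell_index p N k, m) * cell_average p N \<alpha> m u k)"

lemma finite_term_indices [simp]: "finite (term_indices p N)"
  unfolding term_indices_def by (intro finite_SigmaI finite_multi_indices) (auto intro: finite_subset)

lemma step_kernel_eq:
  assumes "p \<ge> 1" "\<alpha> \<subseteq> {1..N}" "k \<in> space (cube {1..N})"
  shows "step_kernel p N a \<alpha> k x =
    (\<Sum>m\<in>multi_indices p \<alpha>. a (\<alpha>, cell_index p N k, m) * cell_weight p \<alpha> m x)"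
proof -
  have "step_kernel p N a \<alpha> k x =
     (\<Sum>i\<in>multi_indices p {1..N}. \<Sum>m\<in>multi_indices p \<alpha>.
       of_nat p ^ card \<alpha> * a (\<alpha>, i, m) * (\<Prod>j\<in>{1..N}. step p (i j) (k j)) * (\<Prod>n\<in>\<alpha>. step p (m n) (x n)))"
    by (simp add: step_kernel_def sum.cartesian_product)
  also have "\<dots> = (\<Sum>i\<in>multi_indices p {1..N}. of_bool (cell_index p N k = i) *
       (\<Sum>m\<in>multi_indices p \<alpha>. a (\<alpha>, i, m) * cell_weight p \<alpha> m x))"
    using assms by (intro sum.cong refl)
      (simp add: prod_step_cell_index cell_weight_def sum_distrib_left mult_ac)
  also have "\<dots> = (\<Sum>m\<in>multi_indices p \<alpha>. a (\<alpha>, cell_index p N k, m) * cell_weight p \<alpha> m x)"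
    using assms by (intro sum_of_bool_eq cell_index_mem) auto
  finally show ?thesis .
qed

text \<open>
  The integrability assumption is needed because the integral of a non-integrable slice is \<open>0\<close>,
  which makes \<open>mixed_integral\<close> additive in the kernels only almost everywhere.
\<close>

lemma mixed_integral_eq_cell_form:
  assumes "p \<ge> 1" "k \<in> space (cube {1..N})"
    and "\<forall>\<alpha>\<in>Pow {1..N}. integrable (cube \<alpha>) (\<lambda>x. u (merge ({1..N} - \<alpha>) \<alpha> (k, x)))"
  shows "mixed_integral p N a u k = cell_form p N a u k"
proof -
  have "(\<integral>x. step_kernel p N a \<alpha> k x * u (merge ({1..N} - \<alpha>) \<alpha> (k, x)) \<partial>cube \<alpha>) =
      (\<Sum>m\<in>multi_indices p \<alpha>. a (\<alpha>, cell_index p N k, m) * cell_average p N \<alpha> m u k)"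
    if \<alpha>: "\<alpha> \<in> Pow {1..N}" for \<alpha>
  proof -
    let ?u = "\<lambda>x. u (merge ({1..N} - \<alpha>) \<alpha> (k, x))"
    have int: "integrable (cube \<alpha>) (\<lambda>x. a (\<alpha>, cell_index p N k, m) * (cell_weight p \<alpha> m x * ?u x))" for m
      using assms(3) \<alpha> by (intro integrable_mult_right integrable_cell_weight_mult) auto
    have "(\<integral>x. step_kernel p N a \<alpha> k x * ?u x \<partial>cube \<alpha>) =
        (\<integral>x. (\<Sum>m\<in>multi_indices p \<alpha>. a (\<alpha>, cell_index p N k, m) * (cell_weight p \<alpha> m x * ?u x)) \<partial>cube \<alpha>)"
      using assms \<alpha> by (simp add: step_kernel_eq sum_distrib_right mult.assoc)
    also have "\<dots> = (\<Sum>m\<in>multi_indices p \<alpha>. a (\<alpha>, cell_index p N k, m) * cell_average p N \<alpha> m u k)"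
      by (subst Bochner_Integration.integral_sum[OF int]) (simp add: cell_average_def)
    finally show ?thesis .
  qed
  then show ?thesis
    unfolding mixed_integral_def cell_form_def term_indices_def
    by (subst sum.Sigma[symmetric]) (auto intro!: finite_multi_indices intro: finite_subset)
qed

lemma mixed_integral_AE:
  assumes "p \<ge> 1" "u \<in> square_integrable N"
  shows "AE k in cube {1..N}. mixed_integral p N a u k = cell_form p N a u k"
  using AE_integrable_slices[OF assms(2)] AE_space
  by eventually_elim (rule mixed_integral_eq_cell_form[OF assms(1)])

lemma square_integrable_cell_form:
  assumes "p \<ge> 1" "u \<in> square_integrable N"
  shows "cell_form p N a u \<in> square_integrable N"
  unfolding cell_form_def[abs_def] case_prod_beta using assms
  by (intro square_integrable_sum square_integrable_cell_index_mult square_integrable_cell_average)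
    (auto simp: term_indices_def)

text \<open>The measure \<open>cube\<close> is not completed, so measurability does not follow from
  almost everywhere equality with \<open>cell_form\<close>; it is derived from the joint
  measurability of kernel and resampled function.\<close>

lemma borel_measurable_mixed_integral:
  assumes "u \<in> borel_measurable (cube {1..N})"
  shows "mixed_integral p N a u \<in> borel_measurable (cube {1..N})"
  unfolding mixed_integral_def[abs_def]
proof (rule borel_measurable_sum)
  fix \<alpha> assume "\<alpha> \<in> Pow {1..N}"
  then have \<alpha>: "\<alpha> \<subseteq> {1..N}" by simp
  then have fin: "finite \<alpha>" by (rule finite_subset) simp
  interpret finite_measure "cube \<alpha>" using fin by (rule finite_measure_cube)
  note [measurable] = measurable_compose[OF measurable_fst measurable_component_cube]
    measurable_compose[OF measurable_snd measurable_component_cube]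
  have "(\<lambda>z. u (merge ({1..N} - \<alpha>) \<alpha> z)) \<in> borel_measurable (cube {1..N} \<Otimes>\<^sub>M cube \<alpha>)"
    using measurable_compose[OF measurable_replace[OF \<alpha>] assms] .
  moreover have "(\<lambda>z. step_kernel p N a \<alpha> (fst z) (snd z)) \<in> borel_measurable (cube {1..N} \<Otimes>\<^sub>M cube \<alpha>)"
    unfolding step_kernel_def case_prod_beta by measurable
  ultimately have "(\<lambda>(k, x). step_kernel p N a \<alpha> k x * u (merge ({1..N} - \<alpha>) \<alpha> (k, x)))
      \<in> borel_measurable (cube {1..N} \<Otimes>\<^sub>M cube \<alpha>)"
    by (simp add: case_prod_beta)
  then show "(\<lambda>k. \<integral>x. step_kernel p N a \<alpha> k x * u (merge ({1..N} - \<alpha>) \<alpha> (k, x)) \<partial>cube \<alpha>)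
      \<in> borel_measurable (cube {1..N})"
    by (rule borel_measurable_lebesgue_integral)
qed

lemma square_integrable_mixed_integral:
  assumes "p \<ge> 1" "u \<in> square_integrable N"
  shows "mixed_integral p N a u \<in> square_integrable N"
  using borel_measurable_mixed_integral[OF square_integrable_measurable[OF assms(2)]]
    square_integrable_cell_form[OF assms] mixed_integral_AE[OF assms]
  by (rule square_integrable_cong_AE)

lemma cell_form_cong_AE:
  assumes "u \<in> borel_measurable (cube {1..N})" "v \<in> borel_measurable (cube {1..N})"
    and "AE k in cube {1..N}. u k = v k"
  shows "AE k in cube {1..N}. cell_form p N a u k = cell_form p N a v k"
proof -
  have "AE k in cube {1..N}. \<forall>s\<in>term_indices p N.
      cell_average p N (fst s) (snd s) u k = cell_average p N (fst s) (snd s) v k"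
    by (intro AE_finite_allI finite_term_indices cell_average_cong_AE assms) (auto simp: term_indices_def)
  then show ?thesis
    by eventually_elim (auto simp: cell_form_def intro!: sum.cong)
qed

lemma mixed_integral_cong_AE:
  assumes "p \<ge> 1" "u \<in> square_integrable N" "v \<in> square_integrable N"
    and "AE k in cube {1..N}. u k = v k"
  shows "AE k in cube {1..N}. mixed_integral p N a u k = mixed_integral p N a v k"
  using cell_form_cong_AE[OF square_integrable_measurable[OF assms(2)] square_integrable_measurable[OF assms(3)] assms(4), of p a]
    mixed_integral_AE[OF assms(1,2), of a] mixed_integral_AE[OF assms(1,3), of a]
  by eventually_elim simp

lemma cell_weight_cong: "(\<And>n. n \<in> \<alpha> \<Longrightarrow> m n = m' n) \<Longrightarrow> cell_weight p \<alpha> m = cell_weight p \<alpha> m'"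
  by (simp add: cell_weight_def fun_eq_iff cong: prod.cong)

lemma cell_average_cong:
  assumes "\<And>n. n \<in> \<alpha> \<Longrightarrow> m n = m' n"
  shows "cell_average p N \<alpha> m u = cell_average p N \<alpha> m' u"
  using cell_weight_cong[of \<alpha> m m' p] assms by (simp add: cell_average_def fun_eq_iff)

text \<open>Fubini on disjoint coordinate sets. The exceptional points are those whose slice over
  \<alpha> \<union> \<beta> fails to be integrable.\<close>

lemma cell_average_disjoint:
  assumes "\<alpha> \<inter> \<beta> = {}" "\<alpha> \<subseteq> {1..N}" "\<beta> \<subseteq> {1..N}" "u \<in> square_integrable N"
  shows "AE k in cube {1..N}. cell_average p N \<alpha> m (cell_average p N \<beta> l u) k =
    cell_average p N (\<alpha> \<union> \<beta>) (merge \<alpha> \<beta> (m, l)) u k"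
proof -
  have fin: "finite \<alpha>" "finite \<beta>" using assms by (auto intro: finite_subset)
  interpret product_sigma_finite "\<lambda>_::nat. restrict_space lborel {0..<1::real}"
    by (rule product_sigma_finite_unit_interval)
  \<comment> \<open>Both the volume factor and the indicator of a cell are multiplicative over
    disjoint sets.\<close>
  have w: "cell_weight p (\<alpha> \<union> \<beta>) (merge \<alpha> \<beta> (m, l)) (merge \<alpha> \<beta> (x, y)) =
      cell_weight p \<alpha> m x * cell_weight p \<beta> l y" for x y
  proof -
    have "(\<Prod>n\<in>\<beta>. step p (merge \<alpha> \<beta> (m, l) n) (merge \<alpha> \<beta> (x, y) n)) = (\<Prod>n\<in>\<beta>. step p (l n) (y n))"
      using assms(1) by (intro prod.cong) (auto simp: merge_def)
    moreover have "(\<Prod>n\<in>\<alpha>. step p (merge \<alpha> \<beta> (m, l) n) (merge \<alpha> \<beta> (x, y) n)) = (\<Prod>n\<in>\<alpha>. step p (m n) (x n))"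
      by (intro prod.cong) (auto simp: merge_def)
    ultimately show ?thesis
      using assms(1) fin by (simp add: cell_weight_def prod.union_disjoint card_Un_disjoint power_add)
  qed
  \<comment> \<open>Resampling \<alpha> and then \<beta> reaches the same point as resampling both
    at once.\<close>
  have r: "merge ({1..N} - (\<alpha> \<union> \<beta>)) (\<alpha> \<union> \<beta>) (k, merge \<alpha> \<beta> (x, y)) =
      merge ({1..N} - \<beta>) \<beta> (merge ({1..N} - \<alpha>) \<alpha> (k, x), y)" for k x y :: "nat \<Rightarrow> real"
    using assms(1,2,3) by (auto simp: merge_def fun_eq_iff)
  from AE_integrable_slices[OF assms(4)] show ?thesis
  proof eventually_elim
    case (elim k)
    let ?u = "\<lambda>z. u (merge ({1..N} - (\<alpha> \<union> \<beta>)) (\<alpha> \<union> \<beta>) (k, z))"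
    have "integrable (cube (\<alpha> \<union> \<beta>)) ?u" using elim assms by auto
    then have "integrable (cube (\<alpha> \<union> \<beta>)) (\<lambda>z. cell_weight p (\<alpha> \<union> \<beta>) (merge \<alpha> \<beta> (m, l)) z * ?u z)"
      by (rule integrable_cell_weight_mult)
    then have "cell_average p N (\<alpha> \<union> \<beta>) (merge \<alpha> \<beta> (m, l)) u k =
        (\<integral>x. (\<integral>y. cell_weight p (\<alpha> \<union> \<beta>) (merge \<alpha> \<beta> (m, l)) (merge \<alpha> \<beta> (x, y)) * ?u (merge \<alpha> \<beta> (x, y)) \<partial>cube \<beta>) \<partial>cube \<alpha>)"
      unfolding cell_average_def cube_def by (intro product_integral_fold assms fin)
    also have "\<dots> = cell_average p N \<alpha> m (cell_average p N \<beta> l u) k"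
      by (simp add: cell_average_def w r mult.assoc)
    finally show ?case by simp
  qed
qed

text \<open>An average over \<beta> no longer depends on the coordinates in \<beta>. Averaging it
  again over some of them integrates a constant against a weight of total mass 1.\<close>

lemma cell_average_subset:
  assumes "p \<ge> 1" "\<gamma> \<subseteq> \<beta>" "\<beta> \<subseteq> {1..N}" "m \<in> multi_indices p \<gamma>"
  shows "cell_average p N \<gamma> m (cell_average p N \<beta> l u) = cell_average p N \<beta> l u"
proof
  fix k
  have "merge ({1..N} - \<beta>) \<beta> (merge ({1..N} - \<gamma>) \<gamma> (k, x), y) = merge ({1..N} - \<beta>) \<beta> (k, y)"
    for x y :: "nat \<Rightarrow> real"
    using assms by (auto simp: merge_def fun_eq_iff)
  then have "cell_average p N \<beta> l u (merge ({1..N} - \<gamma>) \<gamma> (k, x)) = cell_average p N \<beta> l u k" for x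
    by (simp add: cell_average_def)
  then show "cell_average p N \<gamma> m (cell_average p N \<beta> l u) k = cell_average p N \<beta> l u k"
    using integral_cell_weight[of p \<gamma> N m] assms
    by (subst cell_average_def) simp
qed

text \<open>On the overlap the inner average wins: its value is constant in the coordinates of
  \<beta>, so resampling those beforehand has no effect. This reduces \<alpha> to \<alpha> -
  \<beta>, which is disjoint from \<beta>.\<close>

lemma cell_average_cell_average:
  assumes "p \<ge> 1" "\<alpha> \<subseteq> {1..N}" "\<beta> \<subseteq> {1..N}" "m \<in> multi_indices p \<alpha>" "u \<in> square_integrable N"
  shows "AE k in cube {1..N}. cell_average p N \<alpha> m (cell_average p N \<beta> l u) k =
    cell_average p N (\<alpha> \<union> \<beta>) (merge \<beta> (\<alpha> - \<beta>) (l, m)) u k"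
proof -
  let ?m = "restrict m (\<alpha> \<inter> \<beta>)"
  let ?v = "cell_average p N \<beta> l u"
  have v: "?v \<in> square_integrable N"
    using assms by (intro square_integrable_cell_average)
  \<comment> \<open>An idle average over the overlap is inserted, so that the disjoint case can
    assemble \<alpha> from \<alpha> - \<beta> and \<alpha> \<inter> \<beta>.\<close>
  have "cell_average p N (\<alpha> \<inter> \<beta>) ?m ?v = ?v"
    using assms by (intro cell_average_subset) (auto simp: multi_indices_def)
  then have "AE k in cube {1..N}. cell_average p N (\<alpha> - \<beta>) m ?v k =
      cell_average p N ((\<alpha> - \<beta>) \<union> (\<alpha> \<inter> \<beta>)) (merge (\<alpha> - \<beta>) (\<alpha> \<inter> \<beta>) (m, ?m)) ?v k"
    using cell_average_disjoint[of "\<alpha> - \<beta>" "\<alpha> \<inter> \<beta>" N ?v p m ?m] v assms by auto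
  moreover have "(\<alpha> - \<beta>) \<union> (\<alpha> \<inter> \<beta>) = \<alpha>" by auto
  moreover have "cell_average p N \<alpha> (merge (\<alpha> - \<beta>) (\<alpha> \<inter> \<beta>) (m, ?m)) ?v = cell_average p N \<alpha> m ?v"
    by (rule cell_average_cong) (auto simp: merge_def)
  moreover have "AE k in cube {1..N}. cell_average p N (\<alpha> - \<beta>) m ?v k =
      cell_average p N ((\<alpha> - \<beta>) \<union> \<beta>) (merge (\<alpha> - \<beta>) \<beta> (m, l)) u k"
    using assms by (intro cell_average_disjoint) auto
  moreover have "(\<alpha> - \<beta>) \<union> \<beta> = \<alpha> \<union> \<beta>" by auto
  moreover have "cell_average p N (\<alpha> \<union> \<beta>) (merge (\<alpha> - \<beta>) \<beta> (m, l)) u =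
      cell_average p N (\<alpha> \<union> \<beta>) (merge \<beta> (\<alpha> - \<beta>) (l, m)) u"
    by (rule cell_average_cong) (auto simp: merge_def)
  ultimately show ?thesis
    by (auto elim: AE_mp)
qed

lemma merge_multi_indices:
  assumes "i \<in> multi_indices p \<beta>" "m \<in> multi_indices p \<alpha>" "\<gamma> \<subseteq> \<beta>"
  shows "merge \<gamma> \<alpha> (i, m) \<in> multi_indices p (\<gamma> \<union> \<alpha>)"
  using assms by (auto simp: multi_indices_def merge_def PiE_iff extensional_def)

text \<open>The coefficient b is read at the cell of the resampled point, whose coordinates in
  \<alpha> the outer weight has moved into the cell m; by \<open>cell_average_mult\<close> it then
  leaves the integral.\<close>

lemma cell_form_cell_form:
  assumes "p \<ge> 1" "u \<in> square_integrable N"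
  shows "AE k in cube {1..N}. cell_form p N a (cell_form p N b u) k =
    (\<Sum>((\<alpha>, m), (\<beta>, l))\<in>term_indices p N \<times> term_indices p N.
       a (\<alpha>, cell_index p N k, m) * b (\<beta>, merge ({1..N} - \<alpha>) \<alpha> (cell_index p N k, m), l) *
       cell_average p N (\<alpha> \<union> \<beta>) (merge \<beta> (\<alpha> - \<beta>) (l, m)) u k)"
proof -
  let ?I = "term_indices p N"
  let ?f = "\<lambda>t k. b (fst t, cell_index p N k, snd t) * cell_average p N (fst t) (snd t) u k"
  have I: "fst s \<subseteq> {1..N}" "snd s \<in> multi_indices p (fst s)" if "s \<in> ?I" for s
    using that by (auto simp: term_indices_def)
  have f: "?f t \<in> square_integrable N" if "t \<in> ?I" for t
    using square_integrable_cell_index_mult[OF assms(1) square_integrable_cell_average, of "fst t" N u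
        "\<lambda>i. b (fst t, i, snd t)"] I(1)[OF that] assms(2) by simp
  have "AE k in cube {1..N}. \<forall>s\<in>?I. cell_average p N (fst s) (snd s) (\<lambda>k. \<Sum>t\<in>?I. ?f t k) k =
      (\<Sum>t\<in>?I. cell_average p N (fst s) (snd s) (?f t) k)"
    by (intro AE_finite_allI finite_term_indices cell_average_sum_AE I f) auto
  moreover have "AE k in cube {1..N}. \<forall>z\<in>?I \<times> ?I.
      cell_average p N (fst (fst z)) (snd (fst z)) (cell_average p N (fst (snd z)) (snd (snd z)) u) k =
      cell_average p N (fst (fst z) \<union> fst (snd z))
        (merge (fst (snd z)) (fst (fst z) - fst (snd z)) (snd (snd z), snd (fst z))) u k"
    by (intro AE_finite_allI finite_cartesian_product finite_term_indices cell_average_cell_average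
        assms I) auto
  ultimately show ?thesis
  proof eventually_elim
    case (elim k)
    have "cell_form p N b u = (\<lambda>k. \<Sum>t\<in>?I. ?f t k)"
      by (simp add: cell_form_def case_prod_beta fun_eq_iff)
    then have "cell_form p N a (cell_form p N b u) k = (\<Sum>s\<in>?I. a (fst s, cell_index p N k, snd s) *
        (\<Sum>t\<in>?I. cell_average p N (fst s) (snd s) (?f t) k))"
      using elim(1) by (simp add: cell_form_def[of p N a] case_prod_beta)
    also have "\<dots> = (\<Sum>s\<in>?I. a (fst s, cell_index p N k, snd s) *
        (\<Sum>t\<in>?I. b (fst t, merge ({1..N} - fst s) (fst s) (cell_index p N k, snd s), snd t) *
           cell_average p N (fst s) (snd s) (cell_average p N (fst t) (snd t) u) k))"
      using assms(1) I
      by (intro sum.cong refl arg_cong2[where f = "(*)"]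
          cell_average_mult[where g = "\<lambda>i. b (fst t, i, snd t)" for t]) auto
    also have "\<dots> = (\<Sum>s\<in>?I. \<Sum>t\<in>?I. a (fst s, cell_index p N k, snd s) *
        b (fst t, merge ({1..N} - fst s) (fst s) (cell_index p N k, snd s), snd t) *
          cell_average p N (fst s \<union> fst t) (merge (fst t) (fst s - fst t) (snd t, snd s)) u k)"
      using elim(2) by (simp add: sum_distrib_left mult.assoc)
    finally show ?case
      by (simp add: sum.cartesian_product case_prod_beta)
  qed
qed

lemma mixed_integral_compose:
  assumes "p \<ge> 1"
  obtains c where "c \<in> coefficient_families p N"
    and "\<And>u. u \<in> square_integrable N \<Longrightarrow>
      AE k in cube {1..N}. mixed_integral p N a (mixed_integral p N b u) k = mixed_integral p N c u k"
proof -
  let ?I = "term_indices p N"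
  \<comment> \<open>A pair of terms yields one average, with index \<open>tgt\<close> and
    coefficient \<open>co\<close>. Several pairs may share an index, so c sums \<open>co\<close>
    over the fibres of \<open>tgt\<close>.\<close>
  define tgt where "tgt = (\<lambda>((\<alpha>, m), (\<beta>, l)). (\<alpha> \<union> \<beta> :: nat set, merge \<beta> (\<alpha> - \<beta>) (l, m) :: nat \<Rightarrow> nat))"
  define co where "co i = (\<lambda>((\<alpha>, m), (\<beta>, l)). a (\<alpha>, i, m) * b (\<beta>, merge ({1..N} - \<alpha>) \<alpha> (i, m), l))" for i
  define c :: coefficients where
    "c = restrict (\<lambda>(\<gamma>, i, q). \<Sum>t\<in>{t \<in> ?I \<times> ?I. tgt t = (\<gamma>, q)}. co i t)
       (SIGMA \<alpha>:Pow {1..N}. multi_indices p {1..N} \<times> multi_indices p \<alpha>)"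
  have tgt: "tgt ` (?I \<times> ?I) \<subseteq> ?I"
  proof clarsimp
    fix \<alpha> m \<beta> l assume *: "(\<alpha>, m) \<in> ?I" "(\<beta>, l) \<in> ?I"
    \<comment> \<open>Restricting m makes it a multi-index on \<alpha> - \<beta>, as
      \<open>merge_multi_indices\<close> demands, and leaves the merged function as it was.\<close>
    then have "merge \<beta> (\<alpha> - \<beta>) (l, restrict m (\<alpha> - \<beta>)) \<in> multi_indices p (\<beta> \<union> (\<alpha> - \<beta>))"
      by (intro merge_multi_indices[where \<beta> = \<beta>]) (auto simp: term_indices_def multi_indices_def)
    moreover have "merge \<beta> (\<alpha> - \<beta>) (l, restrict m (\<alpha> - \<beta>)) = merge \<beta> (\<alpha> - \<beta>) (l, m)"
      by (auto simp: merge_def fun_eq_iff)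
    moreover have "\<beta> \<union> (\<alpha> - \<beta>) = \<alpha> \<union> \<beta>" by auto
    ultimately show "tgt ((\<alpha>, m), (\<beta>, l)) \<in> ?I"
      using * by (auto simp: tgt_def term_indices_def)
  qed
  show thesis
  proof (rule that)
    show "c \<in> coefficient_families p N"
      by (auto simp: c_def coefficient_families_def)
    fix u assume u: "u \<in> square_integrable N"
    have form: "cell_form p N c u k = (\<Sum>((\<alpha>, m), (\<beta>, l))\<in>?I \<times> ?I.
       a (\<alpha>, cell_index p N k, m) * b (\<beta>, merge ({1..N} - \<alpha>) \<alpha> (cell_index p N k, m), l) *
       cell_average p N (\<alpha> \<union> \<beta>) (merge \<beta> (\<alpha> - \<beta>) (l, m)) u k)" if k: "k \<in> space (cube {1..N})" for k
    proof -
      let ?i = "cell_index p N k"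
      let ?avg = "\<lambda>(\<gamma>, q). cell_average p N \<gamma> q u k"
      have "cell_form p N c u k = (\<Sum>s\<in>?I. (\<Sum>t\<in>{t \<in> ?I \<times> ?I. tgt t = s}. co ?i t) * ?avg s)"
        unfolding cell_form_def using cell_index_mem[OF assms k]
        by (intro sum.cong) (auto simp: c_def term_indices_def)
      also have "\<dots> = (\<Sum>s\<in>?I. \<Sum>t\<in>{t \<in> ?I \<times> ?I. tgt t = s}. co ?i t * ?avg (tgt t))"
        by (simp add: sum_distrib_right)
      also have "\<dots> = (\<Sum>t\<in>?I \<times> ?I. co ?i t * ?avg (tgt t))"
        using tgt by (intro sum.group) auto
      finally show ?thesis
        by (simp add: co_def tgt_def case_prod_beta)
    qed
    note m = square_integrable_measurable
    \<comment> \<open>The outer operator acts on \<open>mixed_integral p N b u\<close>, while the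
      expansion is known for \<open>cell_form p N b u\<close>; the two differ on a null set
      only.\<close>
    have b: "mixed_integral p N b u \<in> square_integrable N" "cell_form p N b u \<in> square_integrable N"
      using assms u by (auto intro: square_integrable_mixed_integral square_integrable_cell_form)
    show "AE k in cube {1..N}. mixed_integral p N a (mixed_integral p N b u) k = mixed_integral p N c u k"
      using mixed_integral_AE[OF assms b(1), of a] mixed_integral_AE[OF assms u, of c]
        cell_form_cong_AE[OF m[OF b(1)] m[OF b(2)] mixed_integral_AE[OF assms u], of p a]
        cell_form_cell_form[OF assms u, of a b] AE_space
      by eventually_elim (simp add: form)
  qed
qed

section \<open>The blocks as matrices on invariant subspaces\<close>

text \<open>The delta for \<beta> retains those l that agree with i on \<gamma> - \<beta>. They
  correspond to the multi-indices on \<beta>, and the full index obtained from i is the same either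
  way. So b is the joint kernel of all terms with \<alpha> \<subseteq> \<gamma>.\<close>

lemma b_coeff_sum_merge:
  assumes "\<gamma> \<subseteq> {1..N}" "i \<in> multi_indices p {1..N}"
  shows "(\<Sum>l\<in>multi_indices p \<gamma>. b_coeff a \<gamma> i l * g (merge ({1..N} - \<gamma>) \<gamma> (i, l))) =
    (\<Sum>\<alpha>\<in>Pow \<gamma>. \<Sum>m\<in>multi_indices p \<alpha>. a (\<alpha>, i, m) * g (merge ({1..N} - \<alpha>) \<alpha> (i, m)))"
proof -
  let ?P = "multi_indices p"
  have fin: "finite \<gamma>" using assms(1) by (rule finite_subset) simp
  have "(\<Sum>l\<in>?P \<gamma>. of_bool (restrict i (\<gamma> - \<beta>) = restrict l (\<gamma> - \<beta>)) * a (\<beta>, i, restrict l \<beta>) *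
          g (merge ({1..N} - \<gamma>) \<gamma> (i, l))) =
        (\<Sum>m\<in>?P \<beta>. a (\<beta>, i, m) * g (merge ({1..N} - \<beta>) \<beta> (i, m)))" if \<beta>: "\<beta> \<subseteq> \<gamma>" for \<beta>
  proof -
    let ?S = "{l \<in> ?P \<gamma>. restrict i (\<gamma> - \<beta>) = restrict l (\<gamma> - \<beta>)}"
    have "(\<Sum>l\<in>?P \<gamma>. of_bool (restrict i (\<gamma> - \<beta>) = restrict l (\<gamma> - \<beta>)) * a (\<beta>, i, restrict l \<beta>) *
          g (merge ({1..N} - \<gamma>) \<gamma> (i, l))) =
        (\<Sum>l\<in>?S. a (\<beta>, i, restrict l \<beta>) * g (merge ({1..N} - \<gamma>) \<gamma> (i, l)))"
      using fin by (intro sum.mono_neutral_cong_right) auto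
    also have "\<dots> = (\<Sum>m\<in>?P \<beta>. a (\<beta>, i, m) * g (merge ({1..N} - \<beta>) \<beta> (i, m)))"
    \<comment> \<open>Coordinates of l in \<gamma> - \<beta> are forced to be those of i; the
      coordinates in \<beta> are free.\<close>
    proof (rule sum.reindex_bij_witness[where i = "\<lambda>m. merge (\<gamma> - \<beta>) \<beta> (i, m)" and j = "\<lambda>l. restrict l \<beta>"])
      fix l assume l: "l \<in> ?S"
      have eq: "i n = l n" if "n \<in> \<gamma> - \<beta>" for n
        using l that by (auto dest: fun_cong[of _ _ n])
      show "merge (\<gamma> - \<beta>) \<beta> (i, restrict l \<beta>) = l"
        using l eq \<beta> by (auto simp: merge_def fun_eq_iff multi_indices_def PiE_iff extensional_def)
      show "restrict l \<beta> \<in> ?P \<beta>"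
        using l \<beta> by (auto simp: multi_indices_def)
      have "merge ({1..N} - \<beta>) \<beta> (i, restrict l \<beta>) = merge ({1..N} - \<gamma>) \<gamma> (i, l)"
        using eq \<beta> assms(1) by (auto simp: merge_def fun_eq_iff)
      then show "a (\<beta>, i, restrict l \<beta>) * g (merge ({1..N} - \<beta>) \<beta> (i, restrict l \<beta>)) =
          a (\<beta>, i, restrict l \<beta>) * g (merge ({1..N} - \<gamma>) \<gamma> (i, l))" by simp
    next
      fix m assume m: "m \<in> ?P \<beta>"
      show "restrict (merge (\<gamma> - \<beta>) \<beta> (i, m)) \<beta> = m"
        using m by (auto simp: merge_def fun_eq_iff multi_indices_def PiE_iff extensional_def)
      have "merge (\<gamma> - \<beta>) \<beta> (i, m) \<in> ?P ((\<gamma> - \<beta>) \<union> \<beta>)"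
        using assms m by (intro merge_multi_indices[where \<beta> = "{1..N}"]) auto
      moreover have "(\<gamma> - \<beta>) \<union> \<beta> = \<gamma>" using \<beta> by auto
      ultimately show "merge (\<gamma> - \<beta>) \<beta> (i, m) \<in> ?S"
        by (auto simp: merge_def fun_eq_iff)
    qed
    finally show ?thesis .
  qed
  then show ?thesis
    unfolding b_coeff_def sum_distrib_right by (subst sum.swap) (auto intro!: sum.cong)
qed

text \<open>Serves to read a single column of a block: in the intended use the indicator is a basis
  vector of the space of cell functions.\<close>

lemma sum_multi_indices_delta:
  fixes f :: "(nat \<Rightarrow> nat) \<Rightarrow> complex"
  assumes "finite \<gamma>" "m \<in> multi_indices p \<gamma>"
  shows "(\<Sum>l\<in>multi_indices p \<gamma>. f l * of_bool (merge (E - \<gamma>) \<gamma> (i, l) = merge (E - \<gamma>) \<gamma> (i, m))) = f m"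
proof -
  have "l = m \<longleftrightarrow> merge (E - \<gamma>) \<gamma> (i, l) = merge (E - \<gamma>) \<gamma> (i, m)" if "l \<in> multi_indices p \<gamma>" for l
  proof
    assume eq: "merge (E - \<gamma>) \<gamma> (i, l) = merge (E - \<gamma>) \<gamma> (i, m)"
    show "l = m"
    proof (rule extensionalityI[where A = \<gamma>])
      fix n assume "n \<in> \<gamma>"
      then show "l n = m n" using fun_cong[OF eq, of n] by (simp add: merge_def)
    qed (use that assms in \<open>auto simp: multi_indices_def PiE_def\<close>)
  qed simp
  then have "(\<Sum>l\<in>multi_indices p \<gamma>. f l * of_bool (merge (E - \<gamma>) \<gamma> (i, l) = merge (E - \<gamma>) \<gamma> (i, m))) =
      (\<Sum>l\<in>multi_indices p \<gamma>. f l * of_bool (l = m))"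
    by (intro sum.cong) auto
  also have "\<dots> = f m" using assms by (intro sum_of_bool_eq) auto
  finally show ?thesis .
qed

definition test_function :: "nat \<Rightarrow> nat \<Rightarrow> nat set \<Rightarrow> ((nat \<Rightarrow> nat) \<Rightarrow> complex) \<Rightarrow> (nat \<Rightarrow> real) \<Rightarrow> complex" where
  "test_function p N \<gamma> g k = g (cell_index p N k) * (\<Prod>n\<in>{1..N} - \<gamma>. half_sign p (k n))"

text \<open>The direct sum of the matrices of all blocks belonging to \<gamma>: the coordinates of i
  outside \<gamma> name the block and are carried along, those inside \<gamma> are the row
  index.\<close>

definition block_action :: "nat \<Rightarrow> nat \<Rightarrow> coefficients \<Rightarrow> nat set \<Rightarrow> ((nat \<Rightarrow> nat) \<Rightarrow> complex) \<Rightarrow> (nat \<Rightarrow> nat) \<Rightarrow> complex" where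
  "block_action p N a \<gamma> g i =
     (\<Sum>l\<in>multi_indices p \<gamma>. b_coeff a \<gamma> i l * g (merge ({1..N} - \<gamma>) \<gamma> (i, l)))"

lemma square_integrable_test_function:
  assumes "p \<ge> 1"
  shows "test_function p N \<gamma> g \<in> square_integrable N"
  unfolding test_function_def[abs_def]
proof (rule square_integrable_cell_index_mult[OF assms])
  note [measurable] = measurable_component_cube
  have "(\<lambda>k. \<Prod>n\<in>{1..N} - \<gamma>. half_sign p (k n)) \<in> borel_measurable (cube {1..N})"
    by measurable
  then show "(\<lambda>k. \<Prod>n\<in>{1..N} - \<gamma>. half_sign p (k n)) \<in> square_integrable N"
    by (rule square_integrable_bounded[where C = 1]) (simp add: prod_norm[symmetric])
qed

text \<open>Each average sends g to its value at the moved cell and the product of signs to itself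
  or to 0. The surviving terms are exactly those gathered by
  \<open>b_coeff_sum_merge\<close>.\<close>

lemma mixed_integral_test_function:
  assumes "p \<ge> 1" "\<gamma> \<subseteq> {1..N}"
  shows "AE k in cube {1..N}. mixed_integral p N a (test_function p N \<gamma> g) k =
    test_function p N \<gamma> (block_action p N a \<gamma> g) k"
  using mixed_integral_AE[OF assms(1) square_integrable_test_function[OF assms(1), of N \<gamma> g], of a] AE_space
proof eventually_elim
  case (elim k)
  let ?i = "cell_index p N k" and ?H = "\<Prod>n\<in>{1..N} - \<gamma>. half_sign p (k n)"
  have i: "?i \<in> multi_indices p {1..N}" using assms(1) elim(2) by (rule cell_index_mem)
  have "mixed_integral p N a (test_function p N \<gamma> g) k = cell_form p N a (test_function p N \<gamma> g) k"
    by (rule elim)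
  also have "\<dots> = (\<Sum>(\<alpha>, m)\<in>term_indices p N.
      a (\<alpha>, ?i, m) * (g (merge ({1..N} - \<alpha>) \<alpha> (?i, m)) * (of_bool (\<alpha> \<subseteq> \<gamma>) * ?H)))"
  proof -
    have "cell_average p N \<alpha> m (test_function p N \<gamma> g) k =
        g (merge ({1..N} - \<alpha>) \<alpha> (?i, m)) * (of_bool (\<alpha> \<subseteq> \<gamma>) * ?H)"
      if "\<alpha> \<subseteq> {1..N}" "m \<in> multi_indices p \<alpha>" for \<alpha> m
      unfolding test_function_def[abs_def]
        cell_average_mult[OF assms(1) that, of g "\<lambda>k. \<Prod>n\<in>{1..N} - \<gamma>. half_sign p (k n)"]
        cell_average_half_sign[OF assms(1) that] ..
    then show ?thesis
      unfolding cell_form_def by (intro sum.cong) (auto simp: term_indices_def)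
  qed
  also have "\<dots> = (\<Sum>\<alpha>\<in>Pow {1..N}. of_bool (\<alpha> \<subseteq> \<gamma>) *
      (\<Sum>m\<in>multi_indices p \<alpha>. a (\<alpha>, ?i, m) * g (merge ({1..N} - \<alpha>) \<alpha> (?i, m))) * ?H)"
  proof -
    have "\<forall>\<alpha>\<in>Pow {1..N}. finite (multi_indices p \<alpha>)"
      by (auto intro!: finite_multi_indices intro: finite_subset)
    then show ?thesis
      unfolding term_indices_def
      by (subst sum.Sigma[symmetric]) (simp_all only: finite_Pow_iff finite_atLeastAtMost
          sum_distrib_left sum_distrib_right mult_ac)
  qed
  \<comment> \<open>The terms with \<alpha> not contained in \<gamma> vanish, which cuts the sum
    down to the subsets entering \<open>b_coeff\<close>.\<close>
  also have "\<dots> = (\<Sum>\<alpha>\<in>Pow \<gamma>.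
      (\<Sum>m\<in>multi_indices p \<alpha>. a (\<alpha>, ?i, m) * g (merge ({1..N} - \<alpha>) \<alpha> (?i, m))) * ?H)"
    using assms(2) by (intro sum.mono_neutral_cong_right) auto
  also have "\<dots> = test_function p N \<gamma> (block_action p N a \<gamma> g) k"
    by (simp add: test_function_def block_action_def b_coeff_sum_merge[OF assms(2) i] sum_distrib_right)
  finally show ?case .
qed

text \<open>Every cell has positive measure, hence contains a point outside a given null set.
  Positivity is used through the weight: it integrates to 1, yet would vanish almost everywhere if
  the cell were exceptional.\<close>

lemma AE_cube_cell:
  assumes "p \<ge> 1" "i \<in> multi_indices p {1..N}" "AE k in cube {1..N}. P k"
  obtains k where "k \<in> space (cube {1..N})" "cell_index p N k = i" "P k"
proof -
  have "\<exists>k\<in>space (cube {1..N}). cell_index p N k = i \<and> P k"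
  proof (rule ccontr)
    assume *: "\<not> ?thesis"
  have "AE k in cube {1..N}. cell_weight p {1..N} i k = 0"
    using assms(3) AE_space
    by eventually_elim (use * assms in \<open>auto simp add: cell_weight_def prod_step_cell_index\<close>)
  then have "(\<integral>k. cell_weight p {1..N} i k \<partial>cube {1..N}) = (\<integral>k. 0 \<partial>cube {1..N})"
    by (intro integral_cong_AE) auto
  then show False
    using integral_cell_weight[of p "{1..N}" N i] assms by simp
  qed
  then show thesis using that by blast
qed

lemma test_function_AE_eqD:
  assumes "p \<ge> 1" "i \<in> multi_indices p {1..N}"
    and "AE k in cube {1..N}. test_function p N \<gamma> g k = test_function p N \<gamma> h k"
  shows "g i = h i"
proof -
  obtain k where k: "cell_index p N k = i" "test_function p N \<gamma> g k = test_function p N \<gamma> h k"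
    using AE_cube_cell[OF assms] by metis
  \<comment> \<open>The signs are 1 or -1, so they cancel at the chosen point.\<close>
  have "(\<Prod>n\<in>{1..N} - \<gamma>. half_sign p (k n)) \<noteq> 0"
    by (auto simp: half_sign_def)
  then show ?thesis
    using k by (auto simp: test_function_def)
qed

lemma b_coeff_unique:
  assumes "p \<ge> 1" "\<And>u. u \<in> square_integrable N \<Longrightarrow>
      AE k in cube {1..N}. mixed_integral p N a u k = mixed_integral p N a' u k"
    and "\<gamma> \<subseteq> {1..N}" "i \<in> multi_indices p {1..N}" "m \<in> multi_indices p \<gamma>"
  shows "b_coeff a \<gamma> i m = b_coeff a' \<gamma> i m"
proof -
  have fin: "finite \<gamma>" using assms(3) by (rule finite_subset) simp
  \<comment> \<open>The indicator of one cell: it agrees with i outside \<gamma> and with m inside,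
    and so selects column m of the block that contains row i.\<close>
  let ?g = "\<lambda>j. of_bool (j = merge ({1..N} - \<gamma>) \<gamma> (i, m)) :: complex"
  have "AE k in cube {1..N}. test_function p N \<gamma> (block_action p N a \<gamma> ?g) k =
      test_function p N \<gamma> (block_action p N a' \<gamma> ?g) k"
    using assms(2)[OF square_integrable_test_function[OF assms(1), of N \<gamma> ?g]]
      mixed_integral_test_function[OF assms(1,3), of a ?g]
      mixed_integral_test_function[OF assms(1,3), of a' ?g]
    by eventually_elim simp
  then have "block_action p N a \<gamma> ?g i = block_action p N a' \<gamma> ?g i"
    by (rule test_function_AE_eqD[OF assms(1,4)])
  then show ?thesis
    by (simp add: block_action_def sum_multi_indices_delta[OF fin assms(5)])
qed

text \<open>On the invariant space the hypothesis says that the block action of c is the composite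
  of those of a and b; evaluation at a basis vector gives an entry of the matrix product.\<close>

lemma b_coeff_compose:
  assumes "p \<ge> 1" "\<And>u. u \<in> square_integrable N \<Longrightarrow>
      AE k in cube {1..N}. mixed_integral p N a (mixed_integral p N b u) k = mixed_integral p N c u k"
    and "\<gamma> \<subseteq> {1..N}" "i \<in> multi_indices p {1..N}" "m \<in> multi_indices p \<gamma>"
  shows "b_coeff c \<gamma> i m =
    (\<Sum>l\<in>multi_indices p \<gamma>. b_coeff a \<gamma> i l * b_coeff b \<gamma> (merge ({1..N} - \<gamma>) \<gamma> (i, l)) m)"
proof -
  have fin: "finite \<gamma>" using assms(3) by (rule finite_subset) simp
  let ?g = "\<lambda>j. of_bool (j = merge ({1..N} - \<gamma>) \<gamma> (i, m)) :: complex"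
  \<comment> \<open>Of two successive replacements on \<gamma> only the last one remains, while the
    part outside \<gamma> persists: no action leaves its block.\<close>
  have mm: "merge ({1..N} - \<gamma>) \<gamma> (merge ({1..N} - \<gamma>) \<gamma> (i, l), l') = merge ({1..N} - \<gamma>) \<gamma> (i, l')"
    for l l' :: "nat \<Rightarrow> nat"
    by (auto simp: merge_def fun_eq_iff)
  note si = square_integrable_test_function[OF assms(1), of N \<gamma>]
  \<comment> \<open>The inner value is a test function only almost everywhere, hence the congruence
    before the outer operator is evaluated.\<close>
  have "AE k in cube {1..N}. test_function p N \<gamma> (block_action p N c \<gamma> ?g) k =
      test_function p N \<gamma> (block_action p N a \<gamma> (block_action p N b \<gamma> ?g)) k"
    using assms(2)[OF si[of ?g]]
      mixed_integral_test_function[OF assms(1,3), of c ?g]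
      mixed_integral_cong_AE[OF assms(1) square_integrable_mixed_integral[OF assms(1) si] si
        mixed_integral_test_function[OF assms(1,3), of b ?g], of a]
      mixed_integral_test_function[OF assms(1,3), of a "block_action p N b \<gamma> ?g"]
    by eventually_elim simp
  then have "block_action p N c \<gamma> ?g i = block_action p N a \<gamma> (block_action p N b \<gamma> ?g) i"
    by (rule test_function_AE_eqD[OF assms(1,4)])
  then show ?thesis
    by (simp add: block_action_def mm sum_multi_indices_delta[OF fin assms(5)])
qed

text \<open>For \<beta> = \<gamma> the delta compares restrictions to the empty set and equals 1.
  The triangular system thus has unit diagonal and is solved without division.\<close>

lemma b_coeff_split:
  assumes "finite \<gamma>" "m \<in> multi_indices p \<gamma>"
  shows "b_coeff a \<gamma> i m = a (\<gamma>, i, m) +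
    (\<Sum>\<beta>\<in>Pow \<gamma> - {\<gamma>}. of_bool (restrict i (\<gamma> - \<beta>) = restrict m (\<gamma> - \<beta>)) * a (\<beta>, i, restrict m \<beta>))"
proof -
  have "restrict m \<gamma> = m" using assms(2) by (simp add: multi_indices_def PiE_restrict)
  then show ?thesis
    unfolding b_coeff_def using assms(1) by (subst sum.remove[of _ \<gamma>]) auto
qed

lemma coefficient_families_eqI:
  assumes "a \<in> coefficient_families p N" "a' \<in> coefficient_families p N"
    and "\<And>\<gamma> i m. \<lbrakk>\<gamma> \<subseteq> {1..N}; i \<in> multi_indices p {1..N}; m \<in> multi_indices p \<gamma>\<rbrakk> \<Longrightarrow>
      b_coeff a \<gamma> i m = b_coeff a' \<gamma> i m"
  shows "a = a'"
proof -
  have "a (\<gamma>, i, m) = a' (\<gamma>, i, m)"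
    if "finite \<gamma>" "\<gamma> \<subseteq> {1..N}" "i \<in> multi_indices p {1..N}" "m \<in> multi_indices p \<gamma>" for \<gamma> i m
    using that
  \<comment> \<open>The smaller sets are met with \<open>restrict m \<beta>\<close>, so m has to
    vary, whereas i is the same throughout the system.\<close>
  proof (induction \<gamma> arbitrary: m rule: finite_psubset_induct)
    case (psubset \<gamma>)
    have "a (\<beta>, i, restrict m \<beta>) = a' (\<beta>, i, restrict m \<beta>)" if "\<beta> \<in> Pow \<gamma> - {\<gamma>}" for \<beta>
    proof (rule psubset.IH)
      show "\<beta> \<subset> \<gamma>" "\<beta> \<subseteq> {1..N}" using that psubset.prems by auto
      show "restrict m \<beta> \<in> multi_indices p \<beta>"
        using that psubset.prems by (auto simp: multi_indices_def)
    qed (rule psubset.prems)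
    then have "(\<Sum>\<beta>\<in>Pow \<gamma> - {\<gamma>}. of_bool (restrict i (\<gamma> - \<beta>) = restrict m (\<gamma> - \<beta>)) * a (\<beta>, i, restrict m \<beta>)) =
        (\<Sum>\<beta>\<in>Pow \<gamma> - {\<gamma>}. of_bool (restrict i (\<gamma> - \<beta>) = restrict m (\<gamma> - \<beta>)) * a' (\<beta>, i, restrict m \<beta>))"
      by (intro sum.cong) simp_all
    then show ?case
      using assms(3)[OF psubset.prems]
      by (simp add: b_coeff_split[OF psubset.hyps(1) psubset.prems(3)])
  qed
  then show ?thesis
    using assms(1,2) unfolding coefficient_families_def
    by (intro PiE_ext[of a _ _ a']) (auto intro: finite_subset[OF _ finite_atLeastAtMost])
qed

lemma b_coeff_restrict:
  assumes "\<gamma> \<subseteq> {1..N}" "i \<in> multi_indices p {1..N}" "m \<in> multi_indices p \<gamma>"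
  shows "b_coeff (restrict a (SIGMA \<alpha>:Pow {1..N}. multi_indices p {1..N} \<times> multi_indices p \<alpha>)) \<gamma> i m =
    b_coeff a \<gamma> i m"
  unfolding b_coeff_def using assms by (intro sum.cong) (auto simp: multi_indices_def)

text \<open>Forward substitution by cardinality: the equation for \<gamma> involves, besides the
  unknown at \<gamma> itself, only unknowns at proper subsets.\<close>

lemma ex_coefficients:
  obtains a where "a \<in> coefficient_families p N"
    and "\<And>\<gamma> i m. \<lbrakk>\<gamma> \<subseteq> {1..N}; i \<in> multi_indices p {1..N}; m \<in> multi_indices p \<gamma>\<rbrakk> \<Longrightarrow>
      b_coeff a \<gamma> i m = f \<gamma> i m"
proof -
  have "\<exists>a. \<forall>\<gamma> i m. finite \<gamma> \<longrightarrow> card \<gamma> < n \<longrightarrow> m \<in> multi_indices p \<gamma> \<longrightarrow> b_coeff a \<gamma> i m = f \<gamma> i m" for n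
  proof (induction n)
    case 0
    show ?case by simp
  next
    case (Suc n)
    then obtain a where a: "\<And>\<gamma> i m. \<lbrakk>finite \<gamma>; card \<gamma> < n; m \<in> multi_indices p \<gamma>\<rbrakk> \<Longrightarrow> b_coeff a \<gamma> i m = f \<gamma> i m"
      by blast
    let ?r = "\<lambda>\<gamma> i m. (\<Sum>\<beta>\<in>Pow \<gamma> - {\<gamma>}. of_bool (restrict i (\<gamma> - \<beta>) = restrict m (\<gamma> - \<beta>)) * a (\<beta>, i, restrict m \<beta>))"
    \<comment> \<open>At size n the unknown is what the known terms leave over. Equations for
      smaller sets keep their validity, since no set of size n occurs in them.\<close>
    define a' where "a' = (\<lambda>(\<gamma>, i, m). if card \<gamma> = n then f \<gamma> i m - ?r \<gamma> i m else a (\<gamma>, i, m))"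
    have "b_coeff a' \<gamma> i m = f \<gamma> i m" if \<gamma>: "finite \<gamma>" "card \<gamma> < Suc n" "m \<in> multi_indices p \<gamma>" for \<gamma> i m
    proof -
      have "card \<beta> \<noteq> n" if "\<beta> \<in> Pow \<gamma> - {\<gamma>}" for \<beta>
      proof -
        have "\<beta> \<subset> \<gamma>" using that by auto
        then have "card \<beta> < card \<gamma>" by (rule psubset_card_mono[OF \<gamma>(1)])
        then show ?thesis using \<gamma>(2) by linarith
      qed
      then have "a' (\<beta>, i, restrict m \<beta>) = a (\<beta>, i, restrict m \<beta>)" if "\<beta> \<in> Pow \<gamma> - {\<gamma>}" for \<beta>
        using that by (simp add: a'_def)
      then have "b_coeff a' \<gamma> i m = a' (\<gamma>, i, m) + ?r \<gamma> i m"
        unfolding b_coeff_split[OF \<gamma>(1,3)] by (intro arg_cong2[where f = "(+)"] sum.cong refl) simp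
      then show ?thesis
        using a[OF \<gamma>(1) _ \<gamma>(3), of i] \<gamma>(2) b_coeff_split[OF \<gamma>(1,3), of a i]
        by (cases "card \<gamma> = n") (auto simp: a'_def)
    qed
    then show ?case by blast
  qed
  then obtain a where a: "\<And>\<gamma> i m. \<lbrakk>finite \<gamma>; card \<gamma> < Suc N; m \<in> multi_indices p \<gamma>\<rbrakk> \<Longrightarrow> b_coeff a \<gamma> i m = f \<gamma> i m"
    by blast
  have "card \<gamma> < Suc N" "finite \<gamma>" if "\<gamma> \<subseteq> {1..N}" for \<gamma>
    using card_mono[OF _ that] that finite_subset by auto
  \<comment> \<open>Subsets of \<open>{1..N}\<close> have fewer than \<open>Suc N\<close> elements;
    restricting the solution makes it extensional, which \<open>b_coeff\<close> does not notice on
    admissible indices.\<close>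
  then show thesis
    by (intro that[of "restrict a (SIGMA \<alpha>:Pow {1..N}. multi_indices p {1..N} \<times> multi_indices p \<alpha>)"])
      (simp_all add: b_coeff_restrict a coefficient_families_def)
qed

section \<open>The isomorphism\<close>

lemma equiv_ae_equal: "equiv (square_integrable N) (ae_equal N)"
proof (rule equivI)
  show "trans (ae_equal N)"
    unfolding ae_equal_def by (rule transI) (auto elim: AE_mp)
qed (auto simp: ae_equal_def refl_on_def intro: symI elim: AE_mp)

lemma ae_equal_class_eqI:
  assumes "u \<in> square_integrable N" "v \<in> square_integrable N" "AE k in cube {1..N}. u k = v k"
  shows "ae_equal N `` {u} = ae_equal N `` {v}"
  using assms by (intro equiv_class_eq[OF equiv_ae_equal]) (simp add: ae_equal_def)

lemma ae_equal_class_eqD: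
  assumes "ae_equal N `` {u} = ae_equal N `` {v}" "u \<in> square_integrable N" "v \<in> square_integrable N"
  shows "AE k in cube {1..N}. u k = v k"
  using eq_equiv_class[OF assms(1) equiv_ae_equal assms(3)] by (simp add: ae_equal_def)

lemma L2_cases:
  assumes "U \<in> L2 N"
  obtains u where "u \<in> square_integrable N" "U = ae_equal N `` {u}"
  using assms unfolding L2_def by (rule quotientE)

lemma L2_classI: "u \<in> square_integrable N \<Longrightarrow> ae_equal N `` {u} \<in> L2 N"
  unfolding L2_def by (rule quotientI)

lemma UN_ae_equal_class:
  assumes "u \<in> square_integrable N"
    and "\<And>v. (u, v) \<in> ae_equal N \<Longrightarrow> F v = F u"
  shows "(\<Union>v\<in>ae_equal N `` {u}. F v) = F u"
proof -
  have "(\<Union>v\<in>ae_equal N `` {u}. F v) = (\<Union>v\<in>ae_equal N `` {u}. F u)"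
    by (rule SUP_cong[OF refl], rule assms(2)) (simp only: Image_singleton_iff)
  also have "\<dots> = F u"
    using equiv_class_self[OF equiv_ae_equal assms(1)] by blast
  finally show ?thesis .
qed

lemma L2_add_class:
  assumes "u \<in> square_integrable N" "v \<in> square_integrable N"
  shows "L2_add N (ae_equal N `` {u}) (ae_equal N `` {v}) = ae_equal N `` {\<lambda>k. u k + v k}"
proof -
  have *: "ae_equal N `` {\<lambda>k. u' k + v' k} = ae_equal N `` {\<lambda>k. u k + v k}"
    if "(u, u') \<in> ae_equal N" "(v, v') \<in> ae_equal N" for u' v'
  proof (rule ae_equal_class_eqI)
    have "AE k in cube {1..N}. u k = u' k" "AE k in cube {1..N}. v k = v' k"
      using that by (auto simp: ae_equal_def)
    then show "AE k in cube {1..N}. u' k + v' k = u k + v k"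
      by eventually_elim simp
  qed (use that in \<open>auto simp: ae_equal_def intro!: square_integrable_add\<close>)
  have uu: "(u, u) \<in> ae_equal N" "(v, v) \<in> ae_equal N"
    using assms by (auto simp: ae_equal_def)
  show ?thesis
    unfolding L2_add_def using uu * by blast
qed

lemma L2_scale_class:
  assumes "u \<in> square_integrable N"
  shows "L2_scale N c (ae_equal N `` {u}) = ae_equal N `` {\<lambda>k. c * u k}"
  unfolding L2_scale_def
proof (rule UN_ae_equal_class[OF assms])
  fix v assume v: "(u, v) \<in> ae_equal N"
  then have "AE k in cube {1..N}. u k = v k" by (simp add: ae_equal_def)
  then have "AE k in cube {1..N}. c * v k = c * u k" by eventually_elim simp
  then show "ae_equal N `` {\<lambda>k. c * v k} = ae_equal N `` {\<lambda>k. c * u k}"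
    using v by (intro ae_equal_class_eqI square_integrable_const_mult) (auto simp: ae_equal_def)
qed

lemma mixed_op_class:
  assumes "p \<ge> 1" "u \<in> square_integrable N"
  shows "mixed_op p N a (ae_equal N `` {u}) = ae_equal N `` {mixed_integral p N a u}"
proof -
  have "ae_equal N `` {mixed_integral p N a v} = ae_equal N `` {mixed_integral p N a u}"
    if "(u, v) \<in> ae_equal N" for v
  proof (rule ae_equal_class_eqI)
    have v: "v \<in> square_integrable N" "AE k in cube {1..N}. u k = v k"
      using that by (auto simp: ae_equal_def)
    show "mixed_integral p N a v \<in> square_integrable N"
      using assms(1) v(1) by (rule square_integrable_mixed_integral)
    show "AE k in cube {1..N}. mixed_integral p N a v k = mixed_integral p N a u k"
      using mixed_integral_cong_AE[OF assms v, of a] by eventually_elim simp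
  qed (use assms in \<open>auto intro: square_integrable_mixed_integral\<close>)
  then have "(\<Union>v\<in>ae_equal N `` {u}. ae_equal N `` {mixed_integral p N a v}) = ae_equal N `` {mixed_integral p N a u}"
    by (rule UN_ae_equal_class[OF assms(2)])
  then show ?thesis
    unfolding mixed_op_def restrict_apply'[OF L2_classI[OF assms(2)]] .
qed

text \<open>Reduces an identity between operators on classes to almost everywhere identities between
  chosen representatives; each algebra operation is treated through it.\<close>

lemma mixed_op_eqI:
  assumes "p \<ge> 1" "F \<in> extensional (L2 N)"
    and "\<And>u. u \<in> square_integrable N \<Longrightarrow> \<exists>v\<in>square_integrable N.
      F (ae_equal N `` {u}) = ae_equal N `` {v} \<and>
      (AE k in cube {1..N}. v k = mixed_integral p N a u k)"
  shows "F = mixed_op p N a"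
proof (rule extensionalityI[OF assms(2)])
  show "mixed_op p N a \<in> extensional (L2 N)" by (simp add: mixed_op_def)
  fix U assume "U \<in> L2 N"
  then obtain u where u: "u \<in> square_integrable N" "U = ae_equal N `` {u}" by (rule L2_cases)
  then obtain v where v: "v \<in> square_integrable N" "F U = ae_equal N `` {v}"
      "AE k in cube {1..N}. v k = mixed_integral p N a u k"
    using assms(3) by blast
  show "F U = mixed_op p N a U"
    unfolding v(2) unfolding u(2) mixed_op_class[OF assms(1) u(1)]
    by (rule ae_equal_class_eqI[OF v(1) square_integrable_mixed_integral[OF assms(1) u(1)] v(3)])
qed

lemma mixed_op_eqD:
  assumes "p \<ge> 1" "mixed_op p N a = mixed_op p N a'" "u \<in> square_integrable N"
  shows "AE k in cube {1..N}. mixed_integral p N a u k = mixed_integral p N a' u k"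
proof (rule ae_equal_class_eqD)
  show "ae_equal N `` {mixed_integral p N a u} = ae_equal N `` {mixed_integral p N a' u}"
    using assms by (metis mixed_op_class)
qed (use assms in \<open>auto intro: square_integrable_mixed_integral\<close>)

lemma inj_on_mixed_op:
  assumes "p \<ge> 1"
  shows "inj_on (mixed_op p N) (coefficient_families p N)"
proof (rule inj_onI)
  fix a a' assume a: "a \<in> coefficient_families p N" "a' \<in> coefficient_families p N"
    and eq: "mixed_op p N a = mixed_op p N a'"
  show "a = a'"
    by (rule coefficient_families_eqI[OF a b_coeff_unique[OF assms mixed_op_eqD[OF assms eq]]])
qed

text \<open>Injectivity of \<open>mixed_op\<close> supplies the uniqueness that the definite
  description requires.\<close>

lemma coefficients_of_mixed_op:
  assumes "p \<ge> 1" "a \<in> coefficient_families p N"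
  shows "coefficients_of p N (mixed_op p N a) = a"
  unfolding coefficients_of_def using assms inj_on_mixed_op[OF assms(1), of N]
  by (intro the_equality) (auto simp: inj_on_def)

text \<open>The value of \<sigma> in terms of coefficients, so that the algebra can be done without
  the definite description in \<open>coefficients_of\<close>.\<close>

definition B_family :: "nat \<Rightarrow> nat \<Rightarrow> coefficients \<Rightarrow>
    nat set \<Rightarrow> (nat \<Rightarrow> nat) \<Rightarrow> (nat \<Rightarrow> nat) \<times> (nat \<Rightarrow> nat) \<Rightarrow> complex" where
  "B_family p N a = (\<lambda>\<alpha>\<in>Pow {1..N}. \<lambda>i\<in>multi_indices p ({1..N} - \<alpha>). B_matrix p N a \<alpha> i)"

lemma sigma_map_mixed_op:
  assumes "p \<ge> 1" "a \<in> coefficient_families p N"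
  shows "sigma_map p N (mixed_op p N a) = B_family p N a"
  by (simp add: sigma_map_def B_family_def coefficients_of_mixed_op[OF assms])

lemma merge_complement_multi_indices:
  assumes "\<alpha> \<subseteq> {1..N}" "i \<in> multi_indices p ({1..N} - \<alpha>)" "m \<in> multi_indices p \<alpha>"
  shows "merge ({1..N} - \<alpha>) \<alpha> (i, m) \<in> multi_indices p {1..N}"
  using merge_multi_indices[OF assms(2,3) order_refl] assms(1) by (simp add: Un_absorb2)

lemma B_family_mem: "B_family p N a \<in> carrier (sigma_target p N)"
  by (simp add: sigma_target_def B_family_def B_matrix_def carrier_matrix_algebra)

lemma B_family_eqI:
  assumes "X \<in> carrier (sigma_target p N)"
    and "\<And>\<alpha> i m n. \<lbrakk>\<alpha> \<subseteq> {1..N}; i \<in> multi_indices p ({1..N} - \<alpha>); m \<in> multi_indices p \<alpha>;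
        n \<in> multi_indices p \<alpha>\<rbrakk> \<Longrightarrow> X \<alpha> i (m, n) = b_coeff a \<alpha> (merge ({1..N} - \<alpha>) \<alpha> (i, m)) n"
  shows "B_family p N a = X"
proof (rule extensionalityI[where A = "Pow {1..N}"])
  have X: "X \<in> (\<Pi>\<^sub>E \<alpha>\<in>Pow {1..N}. \<Pi>\<^sub>E i\<in>multi_indices p ({1..N} - \<alpha>). extensional (multi_indices p \<alpha> \<times> multi_indices p \<alpha>))"
    using assms(1) by (simp only: sigma_target_def product_algebra_simps carrier_matrix_algebra)
  then show "X \<in> extensional (Pow {1..N})" by (simp add: PiE_def)
  show "B_family p N a \<in> extensional (Pow {1..N})" by (simp add: B_family_def)
  fix \<alpha> assume \<alpha>: "\<alpha> \<in> Pow {1..N}"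
  note X\<alpha> = PiE_mem[OF X \<alpha>]
  show "B_family p N a \<alpha> = X \<alpha>"
  proof (rule extensionalityI[where A = "multi_indices p ({1..N} - \<alpha>)"])
    show "X \<alpha> \<in> extensional (multi_indices p ({1..N} - \<alpha>))" using X\<alpha> by (simp add: PiE_def)
    show "B_family p N a \<alpha> \<in> extensional (multi_indices p ({1..N} - \<alpha>))" using \<alpha> by (simp add: B_family_def)
    fix i assume i: "i \<in> multi_indices p ({1..N} - \<alpha>)"
    show "B_family p N a \<alpha> i = X \<alpha> i"
      using \<alpha> i assms(2)[OF _ i] PiE_mem[OF X\<alpha> i]
      by (intro matrix_eqI[where I = "multi_indices p \<alpha>"]) (simp_all add: B_family_def B_matrix_def)
  qed
qed

text \<open>A full multi-index is the same as a block index outside \<gamma> together with a row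
  index on \<gamma>. The blocks therefore list each value of b exactly once, and bijectivity is the
  unique solvability of the triangular system.\<close>

lemma bij_betw_B_family:
  "bij_betw (B_family p N) (coefficient_families p N) (carrier (sigma_target p N))"
proof (rule bij_betwI')
  fix a a' assume a: "a \<in> coefficient_families p N" "a' \<in> coefficient_families p N"
  show "B_family p N a = B_family p N a' \<longleftrightarrow> a = a'"
  proof
    assume eq: "B_family p N a = B_family p N a'"
    show "a = a'"
    proof (rule coefficient_families_eqI[OF a])
      fix \<gamma> i m assume *: "\<gamma> \<subseteq> {1..N}" "i \<in> multi_indices p {1..N}" "m \<in> multi_indices p \<gamma>"
      have r: "restrict i ({1..N} - \<gamma>) \<in> multi_indices p ({1..N} - \<gamma>)" "restrict i \<gamma> \<in> multi_indices p \<gamma>"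
        using * by (auto simp: multi_indices_def)
      have "merge ({1..N} - \<gamma>) \<gamma> (restrict i ({1..N} - \<gamma>), restrict i \<gamma>) = i"
        using * by (auto simp: merge_def fun_eq_iff multi_indices_def PiE_iff extensional_def)
      then show "b_coeff a \<gamma> i m = b_coeff a' \<gamma> i m"
        using fun_cong[OF fun_cong[OF fun_cong[OF eq, of \<gamma>], of "restrict i ({1..N} - \<gamma>)"], of "(restrict i \<gamma>, m)"] * r
        by (simp add: B_family_def B_matrix_def)
    qed
  qed simp
next
  fix X assume X: "X \<in> carrier (sigma_target p N)"
  obtain a where a: "a \<in> coefficient_families p N"
    "\<And>\<gamma> i m. \<lbrakk>\<gamma> \<subseteq> {1..N}; i \<in> multi_indices p {1..N}; m \<in> multi_indices p \<gamma>\<rbrakk> \<Longrightarrow>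
      b_coeff a \<gamma> i m = X \<gamma> (restrict i ({1..N} - \<gamma>)) (restrict i \<gamma>, m)"
    using ex_coefficients[of p N "\<lambda>\<gamma> i m. X \<gamma> (restrict i ({1..N} - \<gamma>)) (restrict i \<gamma>, m)"] by blast
  have "B_family p N a = X"
  proof (rule B_family_eqI[OF X])
    fix \<alpha> i m n assume *: "\<alpha> \<subseteq> {1..N}" "i \<in> multi_indices p ({1..N} - \<alpha>)" "m \<in> multi_indices p \<alpha>" "n \<in> multi_indices p \<alpha>"
    have "restrict (merge ({1..N} - \<alpha>) \<alpha> (i, m)) ({1..N} - \<alpha>) = i"
        "restrict (merge ({1..N} - \<alpha>) \<alpha> (i, m)) \<alpha> = m"
      using * by (auto simp: merge_def fun_eq_iff multi_indices_def PiE_iff extensional_def)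
    then show "X \<alpha> i (m, n) = b_coeff a \<alpha> (merge ({1..N} - \<alpha>) \<alpha> (i, m)) n"
      using a(2)[OF *(1) merge_complement_multi_indices[OF *(1-3)] *(4)] by simp
  qed
  with a(1) show "\<exists>a\<in>coefficient_families p N. X = B_family p N a" by blast
qed (rule B_family_mem)

lemma sigma_target_closed:
  "\<lbrakk>X \<in> carrier (sigma_target p N); Y \<in> carrier (sigma_target p N)\<rbrakk> \<Longrightarrow>
    X \<otimes>\<^bsub>sigma_target p N\<^esub> Y \<in> carrier (sigma_target p N)"
  "\<lbrakk>X \<in> carrier (sigma_target p N); Y \<in> carrier (sigma_target p N)\<rbrakk> \<Longrightarrow>
    X \<oplus>\<^bsub>sigma_target p N\<^esub> Y \<in> carrier (sigma_target p N)"
  "X \<in> carrier (sigma_target p N) \<Longrightarrow>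
    c \<odot>\<^bsub>sigma_target p N\<^esub> X \<in> carrier (sigma_target p N)"
  "\<one>\<^bsub>sigma_target p N\<^esub> \<in> carrier (sigma_target p N)"
  "\<zero>\<^bsub>sigma_target p N\<^esub> \<in> carrier (sigma_target p N)"
proof -
  interpret S: ring "sigma_target p N" by (rule unital_algebraD(2)[OF unital_algebra_sigma_target])
  interpret M: module complex_field "sigma_target p N"
    by (rule unital_algebraD(1)[OF unital_algebra_sigma_target])
  show
    "\<lbrakk>X \<in> carrier (sigma_target p N); Y \<in> carrier (sigma_target p N)\<rbrakk> \<Longrightarrow>
      X \<otimes>\<^bsub>sigma_target p N\<^esub> Y \<in> carrier (sigma_target p N)"
    "\<lbrakk>X \<in> carrier (sigma_target p N); Y \<in> carrier (sigma_target p N)\<rbrakk> \<Longrightarrow>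
      X \<oplus>\<^bsub>sigma_target p N\<^esub> Y \<in> carrier (sigma_target p N)"
    "X \<in> carrier (sigma_target p N) \<Longrightarrow>
      c \<odot>\<^bsub>sigma_target p N\<^esub> X \<in> carrier (sigma_target p N)"
    "\<one>\<^bsub>sigma_target p N\<^esub> \<in> carrier (sigma_target p N)"
    "\<zero>\<^bsub>sigma_target p N\<^esub> \<in> carrier (sigma_target p N)"
    by simp_all
qed

section \<open>Coefficient families for the algebra operations\<close>

abbreviation coefficient_domain where
  "coefficient_domain p N \<equiv> SIGMA \<alpha>:Pow {1..N}. multi_indices p {1..N} \<times> multi_indices p \<alpha>"

lemma restrict_coefficient_families: "restrict a (coefficient_domain p N) \<in> coefficient_families p N"
  by (simp add: coefficient_families_def)

lemma cell_form_restrict: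
  assumes "p \<ge> 1" "k \<in> space (cube {1..N})"
  shows "cell_form p N (restrict a (coefficient_domain p N)) u k = cell_form p N a u k"
  unfolding cell_form_def using cell_index_mem[OF assms]
  by (intro sum.cong) (auto simp: term_indices_def)

lemma mixed_integral_restrict_AE:
  assumes "p \<ge> 1" "u \<in> square_integrable N"
  shows "AE k in cube {1..N}. mixed_integral p N (restrict a (coefficient_domain p N)) u k = cell_form p N a u k"
  using mixed_integral_AE[OF assms, of "restrict a (coefficient_domain p N)"] AE_space
  by eventually_elim (simp add: cell_form_restrict[OF assms(1)])

lemma cell_form_one:
  assumes "k \<in> space (cube {1..N})"
  shows "cell_form p N (\<lambda>(\<alpha>, i, m). of_bool (\<alpha> = {})) u k = u k"
proof -
  \<comment> \<open>The only multi-index on the empty set is the function that is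
    \<open>undefined\<close> everywhere.\<close>
  have "cell_form p N (\<lambda>(\<alpha>, i, m). of_bool (\<alpha> = {})) u k =
      (\<Sum>s\<in>{({}, \<lambda>_. undefined)}. cell_average p N (fst s) (snd s) u k)"
    unfolding cell_form_def case_prod_beta
    by (rule sum.mono_neutral_cong_right[OF finite_term_indices]) (auto simp: term_indices_def multi_indices_def)
  also have "\<dots> = (\<integral>x. u k \<partial>cube {})"
  proof -
    have "merge {1..N} {} (k, x) = k" for x
      using assms by (auto simp: merge_def fun_eq_iff space_cube PiE_iff extensional_def)
    then show ?thesis by (simp add: cell_average_def cell_weight_def)
  qed
  also have "\<dots> = u k"
    by (simp add: measure_space_cube)
  finally show ?thesis .
qed

text \<open>Only \<beta> = {} contributes, and its delta compares i and m on all of \<gamma>; the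
  blocks of the identity are unit matrices.\<close>

lemma b_coeff_one:
  assumes "\<gamma> \<subseteq> {1..N}" "i \<in> multi_indices p {1..N}" "m \<in> multi_indices p \<gamma>"
  shows "b_coeff (\<lambda>(\<alpha>, i, m). of_bool (\<alpha> = {})) \<gamma> i m = of_bool (restrict i \<gamma> = m)"
proof -
  have "finite \<gamma>" using assms(1) by (rule finite_subset) simp
  moreover have "restrict m \<gamma> = m" using assms(3) by (simp add: multi_indices_def PiE_restrict)
  ultimately show ?thesis
    unfolding b_coeff_def by (subst sum.remove[of _ "{}"]) (auto intro!: sum.neutral)
qed

theorem algebra_isomorphism_sigma_map:
  assumes p: "p \<ge> 1"
  shows "algebra_isomorphism complex_field (mixed_algebra p N) (sigma_target p N) (sigma_map p N)"
proof (rule algebra_isomorphism_pullback[OF unital_algebra_sigma_target])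
  let ?C = "coefficient_families p N" and ?A = "mixed_algebra p N" and ?T = "sigma_target p N"
  have carrier: "carrier ?A = mixed_op p N ` ?C" by (simp add: mixed_algebra_def)
  note sigma = sigma_map_mixed_op[OF p]
  note si = square_integrable_mixed_integral[OF p]
  have "bij_betw (mixed_op p N) ?C (carrier ?A)"
    unfolding carrier using inj_on_mixed_op[OF p] by (simp add: bij_betw_def)
  \<comment> \<open>After \<open>mixed_op\<close> the map \<sigma> is \<open>B_family\<close>;
    cancelling the bijection \<open>mixed_op p N\<close> leaves \<sigma> itself.\<close>
  moreover have "bij_betw (sigma_map p N \<circ> mixed_op p N) ?C (carrier ?T)"
    using bij_betw_B_family by (rule bij_betw_cong[THEN iffD1, rotated]) (simp add: sigma)
  ultimately show "bij_betw (sigma_map p N) (carrier ?A) (carrier ?T)"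
    by (simp add: bij_betw_comp_iff)
  \<comment> \<open>Pointwise sums and multiples need not be extensional, as they compute with
    \<open>undefined\<close> outside the domain, so they are restricted again.\<close>
  let ?r = "\<lambda>a. restrict a (coefficient_domain p N)"
  note r = restrict_coefficient_families[where p = p and N = N]
  have b_r: "b_coeff (?r a) \<alpha> (merge ({1..N} - \<alpha>) \<alpha> (i, m)) n = b_coeff a \<alpha> (merge ({1..N} - \<alpha>) \<alpha> (i, m)) n"
    if "\<alpha> \<subseteq> {1..N}" "i \<in> multi_indices p ({1..N} - \<alpha>)" "m \<in> multi_indices p \<alpha>" "n \<in> multi_indices p \<alpha>"
    for a \<alpha> i m n
    using that by (intro b_coeff_restrict merge_complement_multi_indices)
  {
    fix F G assume "F \<in> carrier ?A" "G \<in> carrier ?A"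
    then obtain a b where ab: "a \<in> ?C" "b \<in> ?C" and F: "F = mixed_op p N a" and G: "G = mixed_op p N b"
      by (auto simp: carrier)
    obtain c where c: "c \<in> ?C" "\<And>u. u \<in> square_integrable N \<Longrightarrow>
        AE k in cube {1..N}. mixed_integral p N a (mixed_integral p N b u) k = mixed_integral p N c u k"
      using mixed_integral_compose[OF p] by metis
    have FG: "F \<otimes>\<^bsub>?A\<^esub> G = mixed_op p N c"
    proof (rule mixed_op_eqI[OF p])
      show "F \<otimes>\<^bsub>?A\<^esub> G \<in> extensional (L2 N)" by (simp add: mixed_algebra_def)
      fix u assume u: "u \<in> square_integrable N"
      show "\<exists>v\<in>square_integrable N. (F \<otimes>\<^bsub>?A\<^esub> G) (ae_equal N `` {u}) = ae_equal N `` {v} \<and>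
          (AE k in cube {1..N}. v k = mixed_integral p N c u k)"
        using u c(2)[OF u]
        by (intro bexI[of _ "mixed_integral p N a (mixed_integral p N b u)"])
          (simp_all add: mixed_algebra_def compose_eq L2_classI F G mixed_op_class p si)
    qed
    have "B_family p N c = B_family p N a \<otimes>\<^bsub>?T\<^esub> B_family p N b"
    proof (rule B_family_eqI)
      fix \<alpha> i m n assume *: "\<alpha> \<subseteq> {1..N}" "i \<in> multi_indices p ({1..N} - \<alpha>)" "m \<in> multi_indices p \<alpha>" "n \<in> multi_indices p \<alpha>"
      \<comment> \<open>The summation index l replaces the row m, and i remains: the sum in
        \<open>b_coeff_compose\<close> is the matrix product inside block i.\<close>
      have "merge ({1..N} - \<alpha>) \<alpha> (merge ({1..N} - \<alpha>) \<alpha> (i, m), l) = merge ({1..N} - \<alpha>) \<alpha> (i, l)" for l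
        by (auto simp: merge_def fun_eq_iff)
      then show "(B_family p N a \<otimes>\<^bsub>?T\<^esub> B_family p N b) \<alpha> i (m, n) =
          b_coeff c \<alpha> (merge ({1..N} - \<alpha>) \<alpha> (i, m)) n"
        using b_coeff_compose[OF p c(2) *(1) merge_complement_multi_indices[OF *(1-3)] *(4)] *
        by (simp add: sigma_target_def B_family_def B_matrix_def)
    qed (intro sigma_target_closed B_family_mem)
    then show "F \<otimes>\<^bsub>?A\<^esub> G \<in> carrier ?A \<and> sigma_map p N (F \<otimes>\<^bsub>?A\<^esub> G) = sigma_map p N F \<otimes>\<^bsub>?T\<^esub> sigma_map p N G"
      using FG ab c(1) by (simp add: F G sigma carrier)
    let ?s = "\<lambda>x. a x + b x"
    have FG: "F \<oplus>\<^bsub>?A\<^esub> G = mixed_op p N (?r ?s)"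
    proof (rule mixed_op_eqI[OF p])
      show "F \<oplus>\<^bsub>?A\<^esub> G \<in> extensional (L2 N)" by (simp add: mixed_algebra_def)
      fix u assume u: "u \<in> square_integrable N"
      have "AE k in cube {1..N}. mixed_integral p N a u k + mixed_integral p N b u k =
          mixed_integral p N (?r ?s) u k"
        using mixed_integral_AE[OF p u, of a] mixed_integral_AE[OF p u, of b]
          mixed_integral_restrict_AE[OF p u, of ?s]
        by eventually_elim (simp add: cell_form_def case_prod_beta distrib_right sum.distrib)
      then show "\<exists>v\<in>square_integrable N. (F \<oplus>\<^bsub>?A\<^esub> G) (ae_equal N `` {u}) = ae_equal N `` {v} \<and>
          (AE k in cube {1..N}. v k = mixed_integral p N (?r ?s) u k)"
        using u
        by (intro bexI[of _ "\<lambda>k. mixed_integral p N a u k + mixed_integral p N b u k"])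
          (simp_all add: mixed_algebra_def L2_classI F G mixed_op_class p si L2_add_class square_integrable_add)
    qed
    have "B_family p N (?r ?s) = B_family p N a \<oplus>\<^bsub>?T\<^esub> B_family p N b"
    proof (rule B_family_eqI)
      fix \<alpha> i m n assume *: "\<alpha> \<subseteq> {1..N}" "i \<in> multi_indices p ({1..N} - \<alpha>)" "m \<in> multi_indices p \<alpha>" "n \<in> multi_indices p \<alpha>"
      show "(B_family p N a \<oplus>\<^bsub>?T\<^esub> B_family p N b) \<alpha> i (m, n) =
          b_coeff (?r ?s) \<alpha> (merge ({1..N} - \<alpha>) \<alpha> (i, m)) n"
        unfolding b_r[OF *] using *
        by (simp add: sigma_target_def B_family_def B_matrix_def b_coeff_def distrib_left sum.distrib)
    qed (intro sigma_target_closed B_family_mem)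
    then show "F \<oplus>\<^bsub>?A\<^esub> G \<in> carrier ?A \<and> sigma_map p N (F \<oplus>\<^bsub>?A\<^esub> G) = sigma_map p N F \<oplus>\<^bsub>?T\<^esub> sigma_map p N G"
      using FG ab r by (simp add: F G sigma carrier)
  }
  {
    fix c F assume "F \<in> carrier ?A"
    then obtain a where a: "a \<in> ?C" and F: "F = mixed_op p N a"
      by (auto simp: carrier)
    let ?s = "\<lambda>x. c * a x"
    have cF: "c \<odot>\<^bsub>?A\<^esub> F = mixed_op p N (?r ?s)"
    proof (rule mixed_op_eqI[OF p])
      show "c \<odot>\<^bsub>?A\<^esub> F \<in> extensional (L2 N)" by (simp add: mixed_algebra_def)
      fix u assume u: "u \<in> square_integrable N"
      have "AE k in cube {1..N}. c * mixed_integral p N a u k = mixed_integral p N (?r ?s) u k"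
        using mixed_integral_AE[OF p u, of a] mixed_integral_restrict_AE[OF p u, of ?s]
        by eventually_elim (simp add: cell_form_def case_prod_beta sum_distrib_left mult.assoc)
      then show "\<exists>v\<in>square_integrable N. (c \<odot>\<^bsub>?A\<^esub> F) (ae_equal N `` {u}) = ae_equal N `` {v} \<and>
          (AE k in cube {1..N}. v k = mixed_integral p N (?r ?s) u k)"
        using u
        by (intro bexI[of _ "\<lambda>k. c * mixed_integral p N a u k"])
          (simp_all add: mixed_algebra_def L2_classI F mixed_op_class p si L2_scale_class square_integrable_const_mult)
    qed
    have "B_family p N (?r ?s) = c \<odot>\<^bsub>?T\<^esub> B_family p N a"
    proof (rule B_family_eqI)
      fix \<alpha> i m n assume *: "\<alpha> \<subseteq> {1..N}" "i \<in> multi_indices p ({1..N} - \<alpha>)" "m \<in> multi_indices p \<alpha>" "n \<in> multi_indices p \<alpha>"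
      show "(c \<odot>\<^bsub>?T\<^esub> B_family p N a) \<alpha> i (m, n) = b_coeff (?r ?s) \<alpha> (merge ({1..N} - \<alpha>) \<alpha> (i, m)) n"
        unfolding b_r[OF *] using *
        by (simp add: sigma_target_def B_family_def B_matrix_def b_coeff_def sum_distrib_left mult.left_commute)
    qed (intro sigma_target_closed B_family_mem)
    then show "c \<odot>\<^bsub>?A\<^esub> F \<in> carrier ?A \<and> sigma_map p N (c \<odot>\<^bsub>?A\<^esub> F) = c \<odot>\<^bsub>?T\<^esub> sigma_map p N F"
      using cF a r by (simp add: F sigma carrier)
  }
  let ?o = "\<lambda>(\<alpha> :: nat set, i :: nat \<Rightarrow> nat, m :: nat \<Rightarrow> nat). of_bool (\<alpha> = {}) :: complex"
  have one: "\<one>\<^bsub>?A\<^esub> = mixed_op p N (?r ?o)"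
  proof (rule mixed_op_eqI[OF p])
    show "\<one>\<^bsub>?A\<^esub> \<in> extensional (L2 N)" by (simp add: mixed_algebra_def)
    fix u assume u: "u \<in> square_integrable N"
    have "AE k in cube {1..N}. u k = mixed_integral p N (?r ?o) u k"
      using mixed_integral_restrict_AE[OF p u, of ?o] AE_space
      by eventually_elim (simp add: cell_form_one)
    then show "\<exists>v\<in>square_integrable N. \<one>\<^bsub>?A\<^esub> (ae_equal N `` {u}) = ae_equal N `` {v} \<and>
        (AE k in cube {1..N}. v k = mixed_integral p N (?r ?o) u k)"
      using u by (intro bexI[of _ u]) (simp_all add: mixed_algebra_def L2_classI)
  qed
  have "B_family p N (?r ?o) = \<one>\<^bsub>?T\<^esub>"
  proof (rule B_family_eqI)
    fix \<alpha> i m n assume *: "\<alpha> \<subseteq> {1..N}" "i \<in> multi_indices p ({1..N} - \<alpha>)" "m \<in> multi_indices p \<alpha>" "n \<in> multi_indices p \<alpha>"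
    have "restrict (merge ({1..N} - \<alpha>) \<alpha> (i, m)) \<alpha> = m"
      using * by (auto simp: merge_def fun_eq_iff multi_indices_def PiE_iff extensional_def)
    then show "\<one>\<^bsub>?T\<^esub> \<alpha> i (m, n) = b_coeff (?r ?o) \<alpha> (merge ({1..N} - \<alpha>) \<alpha> (i, m)) n"
      unfolding b_r[OF *] using * b_coeff_one[OF *(1) merge_complement_multi_indices[OF *(1-3)] *(4)]
      by (simp add: sigma_target_def)
  qed (intro sigma_target_closed B_family_mem)
  then show "\<one>\<^bsub>?A\<^esub> \<in> carrier ?A" "sigma_map p N \<one>\<^bsub>?A\<^esub> = \<one>\<^bsub>?T\<^esub>"
    unfolding one using r by (simp_all add: sigma carrier)
  let ?z = "\<lambda>_. 0 :: complex"
  have zero: "\<zero>\<^bsub>?A\<^esub> = mixed_op p N (?r ?z)"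
  proof (rule mixed_op_eqI[OF p])
    show "\<zero>\<^bsub>?A\<^esub> \<in> extensional (L2 N)" by (simp add: mixed_algebra_def)
    fix u assume u: "u \<in> square_integrable N"
    have "AE k in cube {1..N}. 0 = mixed_integral p N (?r ?z) u k"
      using mixed_integral_restrict_AE[OF p u, of ?z] by eventually_elim (simp add: cell_form_def)
    then show "\<exists>v\<in>square_integrable N. \<zero>\<^bsub>?A\<^esub> (ae_equal N `` {u}) = ae_equal N `` {v} \<and>
        (AE k in cube {1..N}. v k = mixed_integral p N (?r ?z) u k)"
      using u by (intro bexI[of _ "\<lambda>k. 0"])
        (simp_all add: mixed_algebra_def L2_classI L2_zero_def square_integrable_zero)
  qed
  have "B_family p N (?r ?z) = \<zero>\<^bsub>?T\<^esub>"
  proof (rule B_family_eqI)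
    fix \<alpha> i m n assume *: "\<alpha> \<subseteq> {1..N}" "i \<in> multi_indices p ({1..N} - \<alpha>)" "m \<in> multi_indices p \<alpha>" "n \<in> multi_indices p \<alpha>"
    show "\<zero>\<^bsub>?T\<^esub> \<alpha> i (m, n) = b_coeff (?r ?z) \<alpha> (merge ({1..N} - \<alpha>) \<alpha> (i, m)) n"
      unfolding b_r[OF *] using * by (simp add: sigma_target_def b_coeff_def)
  qed (intro sigma_target_closed B_family_mem)
  then show "\<zero>\<^bsub>?A\<^esub> \<in> carrier ?A" "sigma_map p N \<zero>\<^bsub>?A\<^esub> = \<zero>\<^bsub>?T\<^esub>"
    unfolding zero using r by (simp_all add: sigma carrier)
qed

text \<open>The equality of the two products is an identification up to the order of blocks and the
  enumeration of their rows, which is why it appears as the existence of an isomorphism.\<close>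

theorem theorem1p1:
  fixes p N :: nat
  assumes "p \<ge> 1" and "N \<ge> 1"
  shows "algebra_isomorphism complex_field (mixed_algebra p N) (sigma_target p N) (sigma_map p N) \<and>
         (\<exists>\<tau>. algebra_isomorphism complex_field (sigma_target p N) (block_algebra p N) \<tau>)"
  using algebra_isomorphism_sigma_map[OF assms(1)]
    ex_algebra_isomorphism_sigma_target_block_algebra by blast

end
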